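(* Let $\mathcal{C}$ be a covering of the plane by complete folding curves which satisfies the local isomorphism property. Then $\mathcal{C}$ is locally isomorphic to a covering by $2$ curves.
   Context: Curves and coverings. Identify $\mathbb{R}^2$ with $\mathbb{C}$ and $\mathbb{Z}^2$ with $\mathbb{Z}+i\mathbb{Z}$. To a sequence $(a_k)_{1\le k\le n-1}$, $(a_k)_{k\in\mathbb{N}^*}$ or $(a_k)_{k\in\mathbb{Z}}$ with all $a_k=\pm1$ are associated the curves $(C_k)_{1\le k\le n}$, $(C_k)_{k\in\mathbb{N}^*}$, $(C_k)_{k\in\mathbb{Z}}$ whose segments are oriented intervals $C_k=[x_k,x_k+\varepsilon_k]$ with $x_k\in\mathbb{Z}+i\mathbb{Z}$, $\varepsilon_k\in\{1,-1,i,-i\}$, and, whenever $C_k,C_{k+1}$ exist, $x_k+\varepsilon_k=x_{k+1}$ and $\varepsilon_{k+1}=i^{a_k}\varepsilon_k$. Curves are rounded at the points $x_{k+1}$ so that they do not pass through them (so curves sharing no unit interval are disjoint). Curves indexed by $\mathbb{Z}$ are called complete and are considered up to a shift of the index. A covering (of the plane) is a set of complete curves such that each nonoriented interval $[z,z+\varepsilon]$ with $z\in\mathbb{Z}+i\mathbb{Z}$, $\varepsilon\in\{1,i\}$ is the support of exactly one segment of exactly one of the curves. Orientation convention: for each $z=x+iy\in\mathbb{Z}+i\mathbb{Z}$, depending on the parity of $x+y$, the segments with endpoint $z$ are $[z,z+1],[z,z-1],[z+i,z],[z-i,z]$, or they are $[z+1,z],[z-1,z],[z,z+i],[z,z-i]$.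 Folding sequences. For a finite sequence $S=(a_1,\dots,a_m)$ put $\overline{S}=(-a_m,\dots,-a_1)$. The $0$-folding sequence is empty, and the $(n+1)$-folding sequences are the sequences $(\overline{S},\varepsilon,S)$ with $S$ an $n$-folding sequence and $\varepsilon=\pm1$. A complete folding sequence is a sequence $(a_k)_{k\in\mathbb{Z}}$ in $\{\pm1\}$ such that each finite block $(a_{k+1},\dots,a_{k+l})$ is a block of consecutive terms of an $n$-folding sequence for some $n$. A complete folding curve is a complete curve associated to such a sequence. Local isomorphism. For sets of curves $\mathcal{B},\mathcal{C}$: $\mathcal{B}\cong\mathcal{C}$ means that $\mathcal{C}$ is the image of $\mathcal{B}$ under a translation; $\mathcal{B}<\mathcal{C}$ means that $\mathcal{B}\ne\mathcal{C}$, each curve of $\mathcal{B}$ is contained in (is a subcurve of) a curve of $\mathcal{C}$, and any consecutive segments of a curve of $\mathcal{C}$ which belong to curves of $\mathcal{B}$ are consecutive in one of them. A covering $\mathcal{C}$ satisfies the local isomorphism property if for each bounded set of curves (finitely many segments) $\mathcal{B}<\mathcal{C}$ there is $r>0$ such that every disc of radius $r$ contains some $\mathcal{B}'<\mathcal{C}$ with $\mathcal{B}'\cong\mathcal{B}$. Coverings $\mathcal{C},\mathcal{D}$ are locally isomorphic if for each bounded $\mathcal{B}<\mathcal{C}$ there is $\mathcal{B}'<\mathcal{D}$ with $\mathcal{B}'\cong\mathcal{B}$, and conversely with $\mathcal{C}$ and $\mathcal{D}$ exchanged. *)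

theory Defs
  imports "HOL-Analysis.Analysis" "HOL-Library.Sublist"
begin

definition gauss_int :: "complex set" where
  "gauss_int = {z. Re z \<in> \<int> \<and> Im z \<in> \<int>}"

(* The pair (x, e) stands for the oriented interval [x, x + e]. *)
type_synonym seg = "complex \<times> complex"

definition unit_seg :: "seg \<Rightarrow> bool" where
  "unit_seg s \<longleftrightarrow> fst s \<in> gauss_int \<and> snd s \<in> {1, -1, \<i>, -\<i>}"

definition seg_end :: "seg \<Rightarrow> complex" where
  "seg_end s = fst s + snd s"

definition seg_support :: "seg \<Rightarrow> complex set" where
  "seg_support s = closed_segment (fst s) (seg_end s)"

definition turn :: "int \<Rightarrow> seg \<Rightarrow> seg \<Rightarrow> bool" where
  "turn a s t \<longleftrightarrow> seg_end s = fst t \<and> snd t = (\<i> powi a) * snd s"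

(* The rounding of curves at lattice points plays no role at the level of segments and is not
   represented: a curve is its sequence of oriented unit intervals. *)

definition complete_curve_of :: "(int \<Rightarrow> int) \<Rightarrow> (int \<Rightarrow> seg) \<Rightarrow> bool" where
  "complete_curve_of a c \<longleftrightarrow>
     range a \<subseteq> {1, -1} \<and> (\<forall>k. unit_seg (c k)) \<and> (\<forall>k. turn (a k) (c k) (c (k + 1)))"

definition complete_curve :: "(int \<Rightarrow> seg) \<Rightarrow> bool" where
  "complete_curve c \<longleftrightarrow> (\<exists>a. complete_curve_of a c)"

definition finite_curve :: "seg list \<Rightarrow> bool" where
  "finite_curve b \<longleftrightarrow> b \<noteq> [] \<and> (\<forall>s\<in>set b. unit_seg s) \<and>
     successively (\<lambda>s t. \<exists>a\<in>{1, -1}. turn a s t) b"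

definition fold_bar :: "int list \<Rightarrow> int list" where
  "fold_bar S = rev (map uminus S)"

inductive folding_seq :: "nat \<Rightarrow> int list \<Rightarrow> bool" where
  zero: "folding_seq 0 []"
| Suc: "folding_seq n S \<Longrightarrow> e \<in> {1, -1} \<Longrightarrow> folding_seq (Suc n) (fold_bar S @ e # S)"

(* "sublist" is the relation of being a block of consecutive terms. *)
definition complete_folding_seq :: "(int \<Rightarrow> int) \<Rightarrow> bool" where
  "complete_folding_seq a \<longleftrightarrow> range a \<subseteq> {1, -1} \<and>
     (\<forall>i j. \<exists>n S. folding_seq n S \<and> sublist (map a [i..j]) S)"

definition complete_folding_curve :: "(int \<Rightarrow> seg) \<Rightarrow> bool" where
  "complete_folding_curve c \<longleftrightarrow> (\<exists>a. complete_folding_seq a \<and> complete_curve_of a c)"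

definition segs :: "(int \<Rightarrow> seg) set \<Rightarrow> seg set" where
  "segs C = (\<Union>c\<in>C. range c)"

definition oriented :: "(int \<Rightarrow> seg) set \<Rightarrow> bool" where
  "oriented C \<longleftrightarrow> (\<exists>p. \<forall>z\<in>gauss_int.
     {s \<in> segs C. fst s = z \<or> seg_end s = z} =
       (if even (\<lfloor>Re z\<rfloor> + \<lfloor>Im z\<rfloor>) = p
        then {(z, 1), (z, -1), (z + \<i>, -\<i>), (z - \<i>, \<i>)}
        else {(z + 1, -1), (z - 1, 1), (z, \<i>), (z, -\<i>)}))"

(* A complete curve is an index-shift class of functions on the integers. A covering is given by
   one representative of each of its curves; uniqueness of the pair (c, k) excludes two distinct
   representatives of the same class, so the cardinality of C is the number of curves. *)
definition covering :: "(int \<Rightarrow> seg) set \<Rightarrow> bool" where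
  "covering C \<longleftrightarrow> (\<forall>c\<in>C. complete_curve c) \<and>
     (\<forall>z\<in>gauss_int. \<forall>e\<in>{1, \<i>}.
        \<exists>!(ck :: (int \<Rightarrow> seg) \<times> int). fst ck \<in> C \<and>
          seg_support (fst ck (snd ck)) = closed_segment z (z + e)) \<and>
     oriented C"

definition bounded_curves :: "seg list set \<Rightarrow> bool" where
  "bounded_curves B \<longleftrightarrow> finite B \<and> (\<forall>b\<in>B. finite_curve b)"

(* The relation B < C for a bounded B and a set C of complete curves. The requirement that B and C
   differ holds automatically, finite curves not being complete (and a covering being nonempty). *)
definition sub_curves :: "seg list set \<Rightarrow> (int \<Rightarrow> seg) set \<Rightarrow> bool" where
  "sub_curves B C \<longleftrightarrow>
     (\<forall>b\<in>B. \<exists>c\<in>C. \<exists>i j. b = map c [i..j]) \<and>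
     (\<forall>c\<in>C. \<forall>i j. i \<le> j \<and> set (map c [i..j]) \<subseteq> (\<Union>b\<in>B. set b) \<longrightarrow>
        (\<exists>b\<in>B. sublist (map c [i..j]) b))"

definition translate :: "complex \<Rightarrow> seg list set \<Rightarrow> seg list set" where
  "translate v B = map (\<lambda>s. (fst s + v, snd s)) ` B"

definition translation_equiv :: "seg list set \<Rightarrow> seg list set \<Rightarrow> bool" where
  "translation_equiv B B' \<longleftrightarrow> (\<exists>v. B' = translate v B)"

definition local_isomorphism_property :: "(int \<Rightarrow> seg) set \<Rightarrow> bool" where
  "local_isomorphism_property C \<longleftrightarrow>
     (\<forall>B. bounded_curves B \<and> sub_curves B C \<longrightarrow>
        (\<exists>r>0. \<forall>z. \<exists>B'. sub_curves B' C \<and> translation_equiv B B' \<and>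
           (\<forall>b\<in>B'. \<forall>s\<in>set b. seg_support s \<subseteq> cball z r)))"

definition locally_embeds :: "(int \<Rightarrow> seg) set \<Rightarrow> (int \<Rightarrow> seg) set \<Rightarrow> bool" where
  "locally_embeds C D \<longleftrightarrow>
     (\<forall>B. bounded_curves B \<and> sub_curves B C \<longrightarrow>
        (\<exists>B'. sub_curves B' D \<and> translation_equiv B B'))"

definition locally_isomorphic :: "(int \<Rightarrow> seg) set \<Rightarrow> (int \<Rightarrow> seg) set \<Rightarrow> bool" where
  "locally_isomorphic C D \<longleftrightarrow> locally_embeds C D \<and> locally_embeds D C"

end

theory Submission
  imports Defs
begin

text \<open>Both curves passing through a lattice point turn the same way there, so a covering is a parity
  (which lattice points horizontal segments leave) together with a sign at every lattice point. By
  compactness, translates of \<open>C\<close> accumulate at coverings \<open>D\<close>, and the local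
  isomorphism property makes every such \<open>D\<close> locally isomorphic to \<open>C\<close>. It remains to
  choose the translations such that the limit has exactly two curves.

  A folding curve contains, for every \<open>n\<close>, the \<open>n\<close>-fold inflation of a single segment, where inflating
  replaces each segment by two perpendicular ones, and one sign per level tells on which side.
  The two pieces of curve through a vertex of a coarse level cover, a few levels below, a neighbourhood
  of some vertex at which both pieces pass. This fails only for sign sequences that follow a
  certain pattern of period four in the wrong phase, which a lookahead of three signs avoids; the
  remaining cases are settled by a finite search through at most six levels. Iterating gives nested
  pairs of pieces which never join and whose union eventually contains any given segment.\<close>

text \<open>Both pieces of a pair come from one curve of \<open>C\<close>: an inflated segment soon
  runs through some vertex twice, and these two passages are the first pair. Along the curve they
  lie more than \<open>k\<close> steps apart, with \<open>k\<close> growing with the sign word, so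
  the connection between them is lost in the limit. The search takes place around one coarse vertex,
  whereas surroundings have to be exhausted at the finest level. Segments that touch there need not
  have touching ancestors, hence the weaker relation \<open>near_seg\<close>. Everything near the
  two passages is among the sixteen segments that meet the vertex or one of its four neighbours, so
  covering these is enough for all finer levels. The nests found for different depths are unrelated
  to each other. They only share the two segments that arrive at the origin, and these name the two
  curves of the limit. A closed orbit in the limit would be a bounded pattern and would occur in
  \<open>C\<close> already. The local isomorphism property enters when bounded parts of
  \<open>C\<close> have to be found in the limit.\<close>

declare split_paired_All [simp del] split_paired_Ex [simp del]

section \<open>Inflation of lattice segments\<close>

type_synonym pt = "int \<times> int"
type_synonym iseg = "pt \<times> pt"

fun padd :: "pt \<Rightarrow> pt \<Rightarrow> pt" where "padd (a, b) (c, d) = (a + c, b + d)"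
fun pneg :: "pt \<Rightarrow> pt" where "pneg (a, b) = (- a, - b)"
fun mulI :: "pt \<Rightarrow> pt" where "mulI (a, b) = (- b, a)"
fun mulT :: "pt \<Rightarrow> pt" where "mulT (a, b) = (a - b, a + b)"

definition units :: "pt list" where "units = [(1, 0), (0, 1), (-1, 0), (0, -1)]"
definition hor :: "pt \<Rightarrow> bool" where "hor d \<longleftrightarrow> snd d = 0"
definition quarter :: "bool \<Rightarrow> pt \<Rightarrow> pt" where "quarter t d = (if t then mulI d else pneg (mulI d))"
definition iend :: "iseg \<Rightarrow> pt" where "iend e = padd (fst e) (snd e)"

text \<open>The orientation convention: horizontal segments leave the even points if \<open>p\<close> holds, and the
  odd points otherwise.\<close>

definition oseg :: "bool \<Rightarrow> iseg \<Rightarrow> bool" where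
  "oseg p e \<longleftrightarrow> snd e \<in> set units \<and> (hor (snd e) \<longleftrightarrow> even (fst (fst e) + snd (fst e)) = p)"

text \<open>The lattice is scaled by \<open>1 + \<i>\<close>, and a segment becomes the two legs of a right isosceles
  triangle. With sign \<open>s\<close>, horizontal segments bulge to the right and vertical ones to the left;
  without it, the other way round.\<close>

fun inflate1 :: "bool \<Rightarrow> iseg \<Rightarrow> iseg list" where
  "inflate1 s (z, d) = (if s = hor d then [(mulT z, d), (padd (mulT z) d, mulI d)]
                    else [(mulT z, mulI d), (padd (mulT z) (mulI d), d)])"

text \<open>Signs are read from the coarsest level to the finest, so that a prefix of the word can
  be carried out on the list and then dropped.\<close>

fun inflate :: "bool list \<Rightarrow> iseg list \<Rightarrow> iseg list" where
  "inflate [] L = L"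
| "inflate (s # ws) L = inflate ws (concat (map (inflate1 s) L))"

text \<open>For a fixed turn \<open>t\<close>, the directions \<open>d\<close> and
  \<open>pneg d\<close> give the two pieces of curve through \<open>v\<close>; together they use the
  four segments at \<open>v\<close>.\<close>

definition pass :: "bool \<Rightarrow> pt \<Rightarrow> pt \<Rightarrow> iseg list" where
  "pass t v d = [(padd v (pneg d), d), (v, quarter t d)]"

text \<open>Midpoints are doubled to remain in the lattice.\<close>

definition mid :: "iseg \<Rightarrow> pt" where "mid e = padd (padd (fst e) (fst e)) (snd e)"

definition l1 :: "pt \<Rightarrow> int" where "l1 z = \<bar>fst z\<bar> + \<bar>snd z\<bar>"

text \<open>The smallest relation that contains sharing an endpoint and that parents inherit from their
  children; it only adds opposite sides of a unit square.\<close>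

definition near_seg :: "iseg \<Rightarrow> iseg \<Rightarrow> bool" where
  "near_seg e f \<longleftrightarrow> l1 (padd (mid f) (pneg (mid e))) \<le> 2"

lemma inflate_append: "inflate ws (A @ B) = inflate ws A @ inflate ws B"
  by (induction ws arbitrary: A B) auto

lemma inflate_append_word: "inflate (u @ ws) L = inflate ws (inflate u L)"
  by (induction u arbitrary: L) auto

lemma inflate_Nil [simp]: "inflate ws [] = []"
  by (induction ws) auto

lemma set_inflate: "set (inflate ws L) = (\<Union>e\<in>set L. set (inflate ws [e]))"
proof (induction L)
  case (Cons e L)
  have "inflate ws (e # L) = inflate ws [e] @ inflate ws L" using inflate_append[of ws "[e]" L]
    by simp
  then show ?case using Cons by simp
qed simp

lemma length_inflate1: "length (inflate1 s e) = 2" by (cases e) auto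

lemma length_inflate: "length (inflate ws L) = 2 ^ length ws * length L"
proof (induction ws arbitrary: L)
  case (Cons s ws)
  have "length (concat (map (inflate1 s) L)) = 2 * length L"
    by (induction L) (auto simp: length_inflate1)
  then show ?case using Cons by simp
qed simp

lemma sublist_inflate: "sublist X Y \<Longrightarrow> sublist (inflate ws X) (inflate ws Y)"
  unfolding sublist_def by (metis inflate_append)

lemma oseg_inflate1: "oseg p e \<Longrightarrow> f \<in> set (inflate1 s e) \<Longrightarrow> oseg s f"
  by (cases e; cases "fst e"; cases "snd e") (auto simp: oseg_def units_def hor_def split: if_splits)

text \<open>First legs start at multiples of 1 + i, that is at even points, so the start of
  \<open>f\<close> tells which leg it is. This leaves two perpendicular directions for the parent,
  and the convention \<open>p\<close> selects one.\<close>

lemma oseg_parent: assumes "oseg s f" shows "\<exists>e. oseg p e \<and> f \<in> set (inflate1 s e)"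
proof -
  obtain x y d where f: "f = ((x, y), d)" by (metis surj_pair)
  show ?thesis
  proof (cases "even (x + y)")
    case True
    then obtain k where k: "x + y = 2 * k" by blast
    have y: "y = 2 * k - x" using k by simp
    \<comment> \<open>This is the start of \<open>f\<close> divided by 1 + i.\<close>
    let ?z = "(k, k - x)"
    have "oseg p (?z, d) \<and> f \<in> set (inflate1 s (?z, d)) \<or> oseg p (?z, pneg (mulI d)) \<and>
      f \<in> set (inflate1 s (?z, pneg (mulI d)))"
      using assms unfolding f y by (auto simp: oseg_def units_def hor_def)
    then show ?thesis by blast
  next
    case False
    then obtain k where k: "x + y = 2 * k + 1" by (metis oddE)
    have y: "y = 2 * k + 1 - x" using k by simp
    obtain a b where d: "d = (a, b)" by fastforce
    have "odd (a + b)" using assms by (auto simp: oseg_def units_def f d)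
    then obtain j where j: "a + b = 2 * j + 1" by (metis oddE)
    have b: "b = 2 * j + 1 - a" using j by simp
    \<comment> \<open>Now \<open>f\<close> is a second leg: its end divided by 1 + i is the end of
      the parent, from which the two possible directions are subtracted.\<close>
    let ?z = "(k + 1 + j - b, k + 1 + j - x)" and ?z' = "(k - j + b, k - j - x)"
    have "oseg p (?z, pneg (mulI d)) \<and> f \<in> set (inflate1 s (?z, pneg (mulI d))) \<or> oseg p (?z', d) \<and>
      f \<in> set (inflate1 s (?z', d))"
      using assms j unfolding f y d by (auto simp: oseg_def units_def hor_def)
    then show ?thesis by blast
  qed
qed

text \<open>The scaled midpoint of the parent is the midpoint of the hypotenuse. It differs from the
  midpoint of a leg by half of the other leg, which the doubling turns into a unit vector.\<close>

lemma mid_inflate1: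
  assumes "e' \<in> set (inflate1 s (z, d))"
  shows "mid e' = padd (mulT (mid (z, d))) (if s = hor d then d else mulI d) \<or>
         mid e' = padd (mulT (mid (z, d))) (pneg (if s = hor d then mulI d else d))"
  using assms by (cases z; cases d) (auto simp: mid_def split: if_splits)

lemma l1_unit: "u \<in> set units \<Longrightarrow> l1 u = 1" by (auto simp: units_def l1_def)

lemma mid_inflate1_unit: "e' \<in> set (inflate1 s (z, d)) \<Longrightarrow> d \<in> set units \<Longrightarrow>
   \<exists>a b. \<bar>a\<bar> + \<bar>b\<bar> = 1 \<and> mid e' = padd (mulT (mid (z, d))) (a, b)"
proof -
  assume "e' \<in> set (inflate1 s (z, d))" and d: "d \<in> set units"
  have "(if s = hor d then d else mulI d) \<in> set units"
    "pneg (if s = hor d then mulI d else d) \<in> set units"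
    using d by (auto simp: units_def)
  then obtain u where "u \<in> set units" "mid e' = padd (mulT (mid (z, d))) u"
    using mid_inflate1[OF \<open>e' \<in> _\<close>] by blast
  then show ?thesis using l1_unit[of u] unfolding l1_def by (metis prod.collapse)
qed

text \<open>The sum of |X - Y| and |X + Y| is twice the maximum of |X| and |Y|.\<close>

lemma abs_sum_le_2: fixes X Y w v :: int assumes "\<bar>X - Y + w\<bar> + \<bar>X + Y + v\<bar> \<le> 2" "\<bar>w\<bar> + \<bar>v\<bar> \<le> 2"
  shows "\<bar>X\<bar> \<le> 2 \<and> \<bar>Y\<bar> \<le> 2"
  using assms by (smt (verit))

text \<open>Scaling by 1 + i takes the maximum norm to half of the l1 norm, and each child is
  displaced by a unit only; so the doubled midpoints of the parents differ by at most 2 in each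
  coordinate. By parity, only differences with both coordinates 2 or -2 remain to be excluded. In
  that case the parents are translates of each other and their legs are too far apart.\<close>

lemma near_seg_parent:
  assumes "oseg p e" "oseg p f" "e' \<in> set (inflate1 s e)" "f' \<in> set (inflate1 s f)" "near_seg e' f'"
  shows "near_seg e f"
proof (rule ccontr)
  assume neg: "\<not> near_seg e f"
  obtain x y d x' y' d' where e: "e = ((x, y), d)" "f = ((x', y'), d')" by (metis surj_pair)
  have d: "d \<in> set units" "d' \<in> set units" using assms by (auto simp: oseg_def e)
  obtain a b c g where ab: "mid e = (a, b)" "mid f = (c, g)" by fastforce
  define X Y where "X = c - a" "Y = g - b"
  then have XY: "c = a + X" "g = b + Y" by auto
  have near_seg: "near_seg e f \<longleftrightarrow> \<bar>X\<bar> + \<bar>Y\<bar> \<le> 2" by (simp add: near_seg_def l1_def ab XY)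
  obtain u1 u2 where u: "\<bar>u1\<bar> + \<bar>u2\<bar> = 1" "mid e' = padd (mulT (mid e)) (u1, u2)"
    using mid_inflate1_unit[OF assms(3)[unfolded e] d(1)] unfolding e by blast
  obtain v1 v2 where v: "\<bar>v1\<bar> + \<bar>v2\<bar> = 1" "mid f' = padd (mulT (mid f)) (v1, v2)"
    using mid_inflate1_unit[OF assms(4)[unfolded e] d(2)] unfolding e by blast
  have "\<bar>X - Y + (v1 - u1)\<bar> + \<bar>X + Y + (v2 - u2)\<bar> \<le> 2"
    using assms(5) by (simp add: near_seg_def l1_def u(2) v(2) ab XY algebra_simps)
  moreover have "\<bar>v1 - u1\<bar> + \<bar>v2 - u2\<bar> \<le> 2" using u(1) v(1) by (smt (verit))
  ultimately have 1: "\<bar>X\<bar> \<le> 2 \<and> \<bar>Y\<bar> \<le> 2" by (rule abs_sum_le_2)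
  have 2: "even (X + Y)" using d ab by (auto simp: X_Y_def e mid_def units_def)
  have 3: "(X = 2 \<or> X = - 2) \<and> (Y = 2 \<or> Y = - 2)" using 1 2 neg unfolding near_seg by presburger
  have 4: "odd a = hor d" "odd c = hor d'" using d ab by (auto simp: e mid_def units_def hor_def)
  have "even X" using 3 by auto
  then have 5: "hor d = hor d'" using 4 XY by simp
  have 6: "even (x + y) = even (x' + y')" using assms(1,2) 5 by (auto simp: oseg_def e)
  \<comment> \<open>Opposite directions would make \<open>X + Y\<close> congruent to 2 modulo
    4.\<close>
  have eq: "d' = d"
  proof (rule ccontr)
    assume "d' \<noteq> d"
    then have "d' = pneg d" using 5 d by (auto simp: units_def hor_def)
    then have "(c, g) = padd (padd (x', y') (x', y')) (pneg d)"
      "(a, b) = padd (padd (x, y) (x, y)) d"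
      using ab by (simp_all add: e mid_def)
    then have "c + g - a - b = 2 * (x' + y' - x - y) - 2 * (fst d + snd d)" by (cases d) auto
    moreover have "odd (fst d + snd d)" using d by (auto simp: units_def)
    moreover have "4 dvd X + Y" using 3 by auto
    ultimately show False using XY 6 by presburger
  qed
  \<comment> \<open>\<open>(w, w')\<close> is the hypotenuse, by which the displacements of the two
    legs differ. It cannot make up for the scaled difference of the parents, which has a coordinate
    4 or -4.\<close>
  have wex: "\<exists>w w'. padd (if s = hor d then d else mulI d) (if s = hor d then mulI d else d) = (w, w') \<and> \<bar>w\<bar> = 1 \<and> \<bar>w'\<bar> = 1"
    using d(1) by (cases "s = hor d") (auto simp: units_def)
  have "(mid e' = padd (mulT (mid e)) (if s = hor d then d else mulI d) \<or>
         mid e' = padd (mulT (mid e)) (pneg (if s = hor d then mulI d else d))) \<and>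
        (mid f' = padd (mulT (mid f)) (if s = hor d then d else mulI d) \<or>
         mid f' = padd (mulT (mid f)) (pneg (if s = hor d then mulI d else d)))"
    using mid_inflate1[OF assms(3)[unfolded e]] mid_inflate1[OF assms(4)[unfolded e]] unfolding e eq
      by blast
  moreover obtain w w'
    where ww: "padd (if s = hor d then d else mulI d) (if s = hor d then mulI d else d) = (w, w')"
    "\<bar>w\<bar> = 1" "\<bar>w'\<bar> = 1"
    using wex by blast
  ultimately have "(v1 - u1, v2 - u2) \<in> {(0, 0), (w, w'), (- w, - w')}"
    unfolding u v ab XY
      by (cases "if s = hor d then d else mulI d"; cases "if s = hor d then mulI d else d") auto
  then have "v1 - u1 = 0 \<and> v2 - u2 = 0 \<or> v1 - u1 = w \<and> v2 - u2 = w' \<or> v1 - u1 = - w \<and>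
    v2 - u2 = - w'" by simp
  moreover have "w = 1 \<or> w = -1" "w' = 1 \<or> w' = -1" using ww(2,3) by linarith+
  moreover note \<open>\<bar>X - Y + (v1 - u1)\<bar> + \<bar>X + Y + (v2 - u2)\<bar> \<le> 2\<close>
  ultimately show False using 3 by (elim conjE disjE) simp_all
qed

text \<open>The parity of its start tells which leg \<open>g\<close> is. A first leg determines the
  start of the parent, hence whether the parent is horizontal, hence its direction. If a second leg
  had two perpendicular parents, their first legs would be opposite, and the starts of the parents
  would have the same parity, against the convention \<open>p\<close>.\<close>

lemma unique_parent:
  assumes "oseg p e" "oseg p f" "g \<in> set (inflate1 s e)" "g \<in> set (inflate1 s f)"
  shows "e = f"
proof -
  obtain x y d x' y' d' where e: "e = ((x, y), d)" "f = ((x', y'), d')" by (metis surj_pair)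
  have d: "d \<in> set units" "d' \<in> set units" using assms by (auto simp: oseg_def e)
  define c1 where "c1 d = (if s = hor d then d else mulI d)" for d
  define c2 where "c2 d = (if s = hor d then mulI d else d)" for d
  have ge: "g = (mulT (x, y), c1 d) \<or> g = (padd (mulT (x, y)) (c1 d), c2 d)"
    using assms(3) by (auto simp: e c1_def c2_def split: if_splits)
  have gf: "g = (mulT (x', y'), c1 d') \<or> g = (padd (mulT (x', y')) (c1 d'), c2 d')"
    using assms(4) by (auto simp: e c1_def c2_def split: if_splits)
  have odd: "odd (fst (c1 d) + snd (c1 d))" if "d \<in> set units" for d
    using that by (auto simp: c1_def units_def)
  have h: "hor d = (even (x + y) = p)" "hor d' = (even (x' + y') = p)" using assms(1,2)
    by (auto simp: oseg_def e)
  have eqd: "d = d'" if "hor d = hor d'" "c1 d = c1 d' \<or> c2 d = c2 d'"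
    using that d by (auto simp: c1_def c2_def units_def split: if_splits)
  have par: "even (fst (mulT z) + snd (mulT z))"
    "even (fst (padd (mulT z) c) + snd (padd (mulT z) c)) = even (fst c + snd c)" for z c
    by (cases z; cases c; simp)+
  consider "g = (mulT (x, y), c1 d)" "g = (mulT (x', y'), c1 d')"
    | "g = (padd (mulT (x, y)) (c1 d), c2 d)" "g = (padd (mulT (x', y')) (c1 d'), c2 d')"
    using ge gf par odd[OF d(1)] odd[OF d(2)] by (metis fst_conv)
  then show ?thesis
  proof cases
    case 1
    then have "x = x'" "y = y'" by auto
    then show ?thesis using eqd h 1 by (auto simp: e)
  next
    case 2
    have "hor d = hor d'"
    proof (rule ccontr)
      assume n: "hor d \<noteq> hor d'"
      then have "padd (c1 d) (c1 d') = (0, 0)" using 2 d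
        by (auto simp: c1_def c2_def units_def hor_def split: if_splits)
      moreover have "padd (mulT (x, y)) (c1 d) = padd (mulT (x', y')) (c1 d')" using 2 by auto
      ultimately have "y' + x' - x - y = 2 * snd (c1 d)"
        by (cases "c1 d"; cases "c1 d'") auto
      then have "even (x + y) = even (x' + y')" by presburger
      then show False using n h by auto
    qed
    moreover from this have "d = d'" using eqd 2 by auto
    ultimately show ?thesis using 2 by (cases "c1 d") (auto simp: e)
  qed
qed

text \<open>Legs obey the convention given by the sign that produced them, so the last sign decides;
  for the empty word it is \<open>p\<close>.\<close>

lemma oseg_inflate: "\<forall>e\<in>set L. oseg p e \<Longrightarrow> f \<in> set (inflate ws L) \<Longrightarrow> oseg (last (p # ws)) f"
proof (induction ws arbitrary: p L)
  case (Cons s ws)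
  have "\<forall>e\<in>set (concat (map (inflate1 s) L)). oseg s e" using oseg_inflate1 Cons.prems(1) by auto
  from Cons.IH[OF this] Cons.prems(2) show ?case by simp
qed simp

lemma inflate_Cons_set: "f \<in> set (inflate (s # ws) [e]) \<longleftrightarrow>
  (\<exists>g\<in>set (inflate1 s e). f \<in> set (inflate ws [g]))"
  using set_inflate[of ws "inflate1 s e"] by auto

lemma oseg_ancestor: "oseg (last (p # ws)) f \<Longrightarrow> \<exists>e. oseg p e \<and> f \<in> set (inflate ws [e])"
proof (induction ws arbitrary: p)
  case (Cons s ws)
  then obtain g where g: "oseg s g" "f \<in> set (inflate ws [g])" by fastforce
  then obtain e where "oseg p e" "g \<in> set (inflate1 s e)" using oseg_parent by blast
  then show ?case using g inflate_Cons_set by blast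
qed (metis inflate.simps(1) last.simps list.set_intros(1))

lemma unique_ancestor:
  "oseg p e \<Longrightarrow> oseg p f \<Longrightarrow> g \<in> set (inflate ws [e]) \<Longrightarrow> g \<in> set (inflate ws [f]) \<Longrightarrow> e = f"
proof (induction ws arbitrary: p e f)
  case (Cons s ws)
  then obtain g1 g2 where g: "g1 \<in> set (inflate1 s e)" "g \<in> set (inflate ws [g1])"
    "g2 \<in> set (inflate1 s f)" "g \<in> set (inflate ws [g2])"
    unfolding inflate_Cons_set by blast
  then have "g1 = g2" using Cons.IH oseg_inflate1 Cons.prems by blast
  then show ?case using unique_parent g Cons.prems by blast
qed simp

lemma near_seg_ancestor:
  "oseg p e \<Longrightarrow> oseg p f \<Longrightarrow> e' \<in> set (inflate ws [e]) \<Longrightarrow> f' \<in> set (inflate ws [f]) \<Longrightarrow> near_seg e' f' \<Longrightarrow>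
    near_seg e f"
proof (induction ws arbitrary: p e f)
  case (Cons s ws)
  then obtain g1 g2 where g: "g1 \<in> set (inflate1 s e)" "e' \<in> set (inflate ws [g1])"
    "g2 \<in> set (inflate1 s f)" "f' \<in> set (inflate ws [g2])"
    unfolding inflate_Cons_set by blast
  then have "near_seg g1 g2" using Cons.IH oseg_inflate1 Cons.prems by blast
  then show ?case using near_seg_parent g Cons.prems by blast
qed simp

section \<open>Translations and end points of inflated lists\<close>

definition shift :: "pt \<Rightarrow> iseg \<Rightarrow> iseg" where "shift v e = (padd v (fst e), snd e)"

lemma padd_assoc: "padd (padd a b) c = padd a (padd b c)" by (cases a; cases b; cases c) simp
lemma padd_commute: "padd a b = padd b a" by (cases a; cases b) simp
lemma padd_0 [simp]: "padd (0, 0) a = a" "padd a (0, 0) = a" by (cases a; simp)+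
lemma padd_pneg [simp]: "padd a (pneg a) = (0, 0)" "padd (pneg a) a = (0, 0)" by (cases a; simp)+
lemma padd_cancel: "padd a b = padd a c \<longleftrightarrow> b = c" "padd b a = padd c a \<longleftrightarrow> b = c"
  by (cases a; cases b; cases c; auto)+
lemma mulT_padd: "mulT (padd a b) = padd (mulT a) (mulT b)" by (cases a; cases b) simp
lemma pneg_pneg [simp]: "pneg (pneg a) = a" by (cases a) simp
lemma mulT_pow_0 [simp]: "(mulT ^^ n) (0, 0) = (0, 0)" by (induction n) simp_all

lemma inflate1_shift: "inflate1 s (shift v e) = map (shift (mulT v)) (inflate1 s e)"
  by (cases e) (auto simp: shift_def mulT_padd padd_assoc)

lemma inflate_shift: "inflate ws (map (shift v) L) = map (shift ((mulT ^^ length ws) v)) (inflate ws L)"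
proof (induction ws arbitrary: v L)
  case (Cons s ws)
  have "concat (map (inflate1 s) (map (shift v) L)) = map (shift (mulT v)) (concat (map (inflate1 s) L))"
    by (induction L) (simp_all add: inflate1_shift)
  then show ?case using Cons[of "mulT v"] by (simp add: funpow_swap1)
qed simp

lemma pass_shift: "pass t (padd v w) d = map (shift v) (pass t w d)"
  by (simp add: pass_def shift_def padd_assoc)

lemma mid_shift: "mid (shift v e) = padd (padd v v) (mid e)"
  by (cases e; cases "fst e"; cases v; cases "snd e") (simp add: mid_def shift_def)

lemma inflate_neq_Nil: "inflate ws L = [] \<longleftrightarrow> L = []"
  using length_inflate[of ws L]
    by (metis length_0_conv mult_eq_0_iff power_not_zero zero_neq_numeral)

lemma inflate1_pair: "\<exists>e1 e2. inflate1 s e = [e1, e2]"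
  by (cases e) simp

lemma inflate_ends:
  "fst (hd (inflate ws [e])) = (mulT ^^ length ws) (fst e) \<and>
    iend (last (inflate ws [e])) = (mulT ^^ length ws) (iend e)"
proof (induction ws arbitrary: e)
  case (Cons s ws)
  obtain z d where e: "e = (z, d)" by (metis prod.collapse)
  obtain e1 e2 where i: "inflate1 s e = [e1, e2]" using inflate1_pair by blast
  have m: "mulT d = padd d (mulI d)" by (cases d) simp
  have "fst e1 = mulT (fst e)" "iend e2 = mulT (iend e)"
    using i by (auto simp: e iend_def mulT_padd m padd_assoc padd_commute[of d] split: if_splits)
  moreover have "inflate (s # ws) [e] = inflate ws [e1] @ inflate ws [e2]"
    using inflate_append[of ws "[e1]" "[e2]"] i by simp
  ultimately show ?case using Cons[of e1] Cons[of e2] by (simp add: inflate_neq_Nil funpow_swap1)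
qed simp

lemma inflate_hd_last:
  assumes "L \<noteq> []"
  shows "fst (hd (inflate ws L)) = (mulT ^^ length ws) (fst (hd L))"
    "iend (last (inflate ws L)) = (mulT ^^ length ws) (iend (last L))"
proof -
  have "inflate ws L = inflate ws [hd L] @ inflate ws (tl L)" using inflate_append[of ws "[hd L]"
    "tl L"] assms by simp
  then show "fst (hd (inflate ws L)) = (mulT ^^ length ws) (fst (hd L))"
    using inflate_ends[of ws "hd L"] by (simp add: inflate_neq_Nil)
  have "inflate ws L = inflate ws (butlast L) @ inflate ws [last L]"
    using inflate_append[of ws "butlast L" "[last L]"] assms by simp
  then show "iend (last (inflate ws L)) = (mulT ^^ length ws) (iend (last L))"
    using inflate_ends[of ws "last L"] by (simp add: inflate_neq_Nil)
qed

section \<open>Turns of an inflated segment\<close>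

fun walk :: "iseg \<Rightarrow> bool list \<Rightarrow> iseg list" where
  "walk e [] = [e]"
| "walk e (t # S) = e # walk (iend e, quarter t (snd e)) S"

text \<open>The turns, \<open>True\<close> being to the left, along the inflation of a segment that
  is horizontal iff \<open>h\<close> holds. Whatever \<open>h\<close> is, the first leg is
  horizontal iff \<open>s\<close> holds, and the second iff it does not.\<close>

fun turns :: "bool list \<Rightarrow> bool \<Rightarrow> bool list" where
  "turns [] h = []"
| "turns (s # ws) h = turns ws s @ (s = h) # turns ws (\<not> s)"

lemma walk_neq_Nil [simp]: "walk e S \<noteq> []" by (cases S) auto
lemma hd_walk [simp]: "hd (walk e S) = e" by (cases S) auto

lemma walk_append: "walk e (S @ t # S') = walk e S @ walk (iend (last (walk e S)), quarter t (snd (last (walk e S)))) S'"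
  by (induction S arbitrary: e) auto

text \<open>One of two consecutive segments is horizontal and the other vertical, so they bulge to
  different sides. The last leg of \<open>e\<close> and the first leg of \<open>f\<close> are then
  rotated against \<open>e\<close> and \<open>f\<close> by the same angle, which preserves the turn
  between them.\<close>

lemma inflate_turn:
  assumes "snd e \<in> set units" "snd f = quarter t (snd e)"
  shows "snd (hd (inflate ws [f])) = quarter t (snd (last (inflate ws [e])))"
  using assms
proof (induction ws arbitrary: e f)
  case (Cons s ws)
  obtain z d z' d' where e: "e = (z, d)" "f = (z', d')" by (metis prod.collapse)
  obtain e1 e2 f1 f2 where i: "inflate1 s e = [e1, e2]" "inflate1 s f = [f1, f2]"
    using inflate1_pair by meson
  have "snd e2 \<in> set units \<and> snd f1 = quarter t (snd e2)"
    using i Cons.prems by (cases t) (auto simp: e quarter_def units_def hor_def split: if_splits)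
  from Cons.IH[OF conjunct1[OF this] conjunct2[OF this]]
  have IH: "snd (hd (inflate ws [f1])) = quarter t (snd (last (inflate ws [e2])))" .
  have "inflate (s # ws) [e] = inflate ws [e1] @ inflate ws [e2]"
    "inflate (s # ws) [f] = inflate ws [f1] @ inflate ws [f2]"
    using inflate_append[of ws "[e1]" "[e2]"] inflate_append[of ws "[f1]" "[f2]"] i by simp_all
  then show ?case using IH by (simp add: inflate_neq_Nil)
qed simp

lemma inflate_walk:
  assumes "snd e \<in> set units"
  shows "inflate ws [e] = walk (hd (inflate ws [e])) (turns ws (hor (snd e)))"
  using assms
proof (induction ws arbitrary: e)
  case (Cons s ws)
  obtain z d where e: "e = (z, d)" by (metis prod.collapse)
  obtain e1 e2 where i: "inflate1 s e = [e1, e2]" using inflate1_pair by blast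
  have u: "snd e1 \<in> set units" "snd e2 \<in> set units" "hor (snd e1) = s" "hor (snd e2) = (\<not> s)"
    "snd e2 = quarter (s = hor d) (snd e1)" "fst e2 = iend e1"
    using i Cons.prems by (auto simp: e iend_def quarter_def units_def hor_def split: if_splits)
  have "inflate (s # ws) [e] = inflate ws [e1] @ inflate ws [e2]"
    using inflate_append[of ws "[e1]" "[e2]"] i by simp
  moreover have "hd (inflate ws [e2]) = (iend (last (inflate ws [e1])), quarter (s = hor d) (snd (last (inflate ws [e1]))))"
    using inflate_turn[OF u(1,5), of ws] inflate_ends[of ws e1] inflate_ends[of ws e2] u(6)
      by (metis prod.collapse)
  ultimately show ?case using Cons.IH[OF u(1)] Cons.IH[OF u(2)] u(3,4)
    by (simp add: walk_append e inflate_neq_Nil)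
qed simp

section \<open>Finite search\<close>

text \<open>The first three signs of the two words for which, when they continue with period four, the
  pieces around a vertex with incoming direction \<open>d\<close> are disjoint wedges of angle 45 degrees, so
  that no depth of the search suffices.\<close>

definition exceptional3 :: "pt \<Rightarrow> bool \<Rightarrow> bool \<Rightarrow> bool \<Rightarrow> bool" where
  "exceptional3 d a b c \<longleftrightarrow> (if a = hor d then a = b \<and> c \<noteq> a else b \<noteq> a \<and> b = c)"

definition exceptional :: "pt \<Rightarrow> bool list \<Rightarrow> bool" where
  "exceptional d ws \<longleftrightarrow> (\<exists>a b c r. ws = a # b # c # r \<and> exceptional3 d a b c)"

text \<open>Positions of the doubled midpoints of the sixteen segments at a vertex or at one of its
  neighbours, relative to the doubled vertex.\<close>

definition ring16 :: "pt list" where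
  "ring16 = [(1,0),(-1,0),(0,1),(0,-1),(3,0),(-3,0),(0,3),(0,-3),(2,1),(2,-1),(-2,1),(-2,-1),(1,2),(1,-2),(-1,2),(-1,-2)]"

text \<open>Everything evaluated below is written with conditionals: the simplifier evaluates both
  arguments of a conjunction, but only the condition of a conditional.\<close>

fun ex_in :: "('a \<Rightarrow> bool) \<Rightarrow> 'a list \<Rightarrow> bool" where
  "ex_in P [] = False"
| "ex_in P (x # xs) = (if P x then True else ex_in P xs)"

fun all_in :: "('a \<Rightarrow> bool) \<Rightarrow> 'a list \<Rightarrow> bool" where
  "all_in P [] = True"
| "all_in P (x # xs) = (if P x then all_in P xs else False)"

fun eq_pt :: "pt \<Rightarrow> pt \<Rightarrow> bool" where
  "eq_pt (a, b) (c, d) = (if a = c then b = d else False)"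

fun eq_seg :: "iseg \<Rightarrow> iseg \<Rightarrow> bool" where
  "eq_seg (a, b) (c, d) = (if eq_pt a c then eq_pt b d else False)"

fun block2 :: "iseg list \<Rightarrow> iseg list \<Rightarrow> bool" where
  "block2 [e, f] (a # b # L) =
    (if eq_seg e a then
      if eq_seg f b then True else block2 [e, f] (b # L) else block2 [e, f] (b # L))"
| "block2 _ _ = False"

fun near :: "pt \<Rightarrow> iseg list \<Rightarrow> pt list" where
  "near w [] = []"
| "near w (e # L) = (let r = padd (mid e) (pneg w) in if l1 r \<le> 3 then r # near w L else near w L)"

fun mem_pt :: "pt list \<Rightarrow> pt \<Rightarrow> bool" where
  "mem_pt [] p = False"
| "mem_pt (q # L) p = (if eq_pt p q then True else mem_pt L p)"

fun covers :: "pt list \<Rightarrow> pt list \<Rightarrow> bool" where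
  "covers L [] = True"
| "covers L (p # P) = (if mem_pt L p then covers L P else False)"

text \<open>The demand on \<open>a\<close>, \<open>b\<close>, \<open>c\<close> allows a new search
  to start from the vertex found. Looking for this vertex at only three places near the origin turns
  out to suffice.\<close>

definition target :: "bool \<Rightarrow> bool \<Rightarrow> bool \<Rightarrow> bool \<Rightarrow> iseg list \<Rightarrow> iseg list \<Rightarrow> bool" where
  "target t a b c A B \<longleftrightarrow> ex_in (\<lambda>d. if exceptional3 d a b c then False else
     ex_in (\<lambda>v. if block2 (pass t v d) A
       then if block2 (pass t v (pneg d)) B then covers (near (padd v v) (A @ B)) ring16 else False
       else False) [(0,0),(1,0),(0,1)]) units"

text \<open>Three signs of the word are known at any time. Going down one level uses up the first of
  them, and the search must succeed for both values of the sign that comes into view.\<close>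

fun search :: "nat \<Rightarrow> bool \<Rightarrow> bool \<Rightarrow> bool \<Rightarrow> bool \<Rightarrow> iseg list \<Rightarrow> iseg list \<Rightarrow> bool" where
  "search 0 t a b c A B = target t a b c A B"
| "search (Suc n) t a b c A B = (if target t a b c A B then True
     else if search n t b c True (inflate [a] A) (inflate [a] B) then search n t b c False (inflate [a] A) (inflate [a] B)
     else False)"

text \<open>Three equal turns in succession bring the curve back to the same vertex after four segments.\<close>

fun loop_at :: "bool \<Rightarrow> bool \<Rightarrow> bool \<Rightarrow> iseg list \<Rightarrow> iseg list \<Rightarrow> bool" where
  "loop_at a b c L (e0 # e1 # e2 # e3 # e4 # e5 # M) =
     (if eq_pt (fst e1) (fst e5) then
        if exceptional3 (snd e0) a b c then loop_at a b c L (e1 # e2 # e3 # e4 # e5 # M)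
        else ex_in (\<lambda>t. if block2 (pass t (fst e1) (snd e0)) L
                   then block2 (pass t (fst e1) (pneg (snd e0))) L else False) [True, False]
      else loop_at a b c L (e1 # e2 # e3 # e4 # e5 # M))"
| "loop_at _ _ _ _ _ = False"

fun search_loop :: "nat \<Rightarrow> bool \<Rightarrow> bool \<Rightarrow> bool \<Rightarrow> iseg list \<Rightarrow> bool" where
  "search_loop 0 a b c L = loop_at a b c L L"
| "search_loop (Suc n) a b c L = (if loop_at a b c L L then True
     else if search_loop n b c True (inflate [a] L) then search_loop n b c False (inflate [a] L) else False)"

definition search_all :: "bool \<Rightarrow> pt \<Rightarrow> bool" where
  "search_all t d = all_in (\<lambda>a. all_in (\<lambda>b. all_in (\<lambda>c. if exceptional3 d a b c then True
     else search 6 t a b c (pass t (0,0) d) (pass t (0,0) (pneg d)))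
     [True, False]) [True, False]) [True, False]"

definition search_loop_all :: "pt \<Rightarrow> bool" where
  "search_loop_all d = all_in (\<lambda>a. all_in (\<lambda>b. all_in (\<lambda>c. search_loop 5 a b c [((0,0), d)])
     [True, False]) [True, False]) [True, False]"

lemma search_loop_all: "d \<in> set units \<Longrightarrow> search_loop_all d"
proof -
  have "search_loop_all (1, 0)" "search_loop_all (0, 1)" "search_loop_all (-1, 0)"
    "search_loop_all (0, -1)"
    by code_simp+
  then show "d \<in> set units \<Longrightarrow> search_loop_all d" by (auto simp: units_def)
qed

lemma search_all_1: "search_all True (1, 0)" by code_simp
lemma search_all_2: "search_all True (0, 1)" by code_simp
lemma search_all_3: "search_all False (1, 0)" by code_simp
lemma search_all_4: "search_all False (0, 1)" by code_simp

section \<open>Soundness of the search\<close>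

lemma ex_in_iff: "ex_in P L \<longleftrightarrow> (\<exists>x\<in>set L. P x)" by (induction L) auto
lemma all_in_iff: "all_in P L \<longleftrightarrow> (\<forall>x\<in>set L. P x)" by (induction L) auto
lemma eq_pt_iff: "eq_pt p q \<longleftrightarrow> p = q" by (cases p; cases q) auto
lemma eq_seg_iff: "eq_seg e f \<longleftrightarrow> e = f" by (cases e; cases f) (auto simp: eq_pt_iff)
lemma mem_pt_iff: "mem_pt L p \<longleftrightarrow> p \<in> set L" by (induction L) (auto simp: eq_pt_iff)
lemma covers_iff: "covers L P \<longleftrightarrow> set P \<subseteq> set L" by (induction P) (auto simp: mem_pt_iff)

lemma block2_sublist: "block2 X L \<Longrightarrow> sublist X L"
proof (induction X L rule: block2.induct)
  case (1 e f a b L)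
  then show ?case by (auto simp: eq_seg_iff sublist_Cons_right split: if_splits)
qed auto

lemma near_mid: "r \<in> set (near w L) \<Longrightarrow> \<exists>g\<in>set L. mid g = padd w r"
proof (induction L)
  case (Cons e L)
  have "mid e = padd w (padd (mid e) (pneg w))"
    by (metis padd_assoc padd_commute padd_pneg(1) padd_0(2))
  then show ?case using Cons by (auto simp: Let_def split: if_splits)
qed simp

text \<open>The ring condition speaks of midpoints only; under the orientation convention a midpoint
  determines the segment, by \<open>mid_inj\<close>.\<close>

definition good_target :: "bool \<Rightarrow> bool list \<Rightarrow> pt \<Rightarrow> pt \<Rightarrow> iseg list \<Rightarrow> iseg list \<Rightarrow> bool" where
  "good_target t ws v d A B \<longleftrightarrow> d \<in> set units \<and> \<not> exceptional d ws \<and> 3 \<le> length ws \<and>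
     sublist (pass t v d) A \<and> sublist (pass t v (pneg d)) B \<and>
     (\<forall>r\<in>set ring16. \<exists>g\<in>set A \<union> set B. mid g = padd (padd v v) r)"

lemma ex_Cons3: "3 \<le> length ws \<Longrightarrow> \<exists>a b c r. ws = a # b # c # r"
  by (auto simp: numeral_3_eq_3 Suc_le_length_iff)

lemma bool_in_list: "x \<in> set [True, False]"
  by (cases x) auto

lemma target_sound:
  assumes "target t a b c A B"
  shows "\<exists>v d. good_target t (a # b # c # ws) v d A B"
proof -
  obtain d v where "d \<in> set units" "\<not> exceptional3 d a b c" "block2 (pass t v d) A"
    "block2 (pass t v (pneg d)) B"
    "covers (near (padd v v) (A @ B)) ring16"
    using assms unfolding target_def ex_in_iff if_bool_eq_conj by blast
  moreover from this have "\<exists>g\<in>set A \<union> set B. mid g = padd (padd v v) r" if "r \<in> set ring16" for r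
    using near_mid[of r "padd v v" "A @ B"] that unfolding covers_iff by auto
  moreover from calculation have "\<not> exceptional d (a # b # c # ws)" by (simp add: exceptional_def)
  ultimately have "good_target t (a # b # c # ws) v d A B"
    using block2_sublist unfolding good_target_def by simp
  then show ?thesis by blast
qed

lemma search_sound:
  "search n t a b c A B \<Longrightarrow> n + 3 \<le> length (a # b # c # ws) \<Longrightarrow>
   \<exists>u ws' v d. a # b # c # ws = u @ ws' \<and> length u \<le> n \<and> good_target t ws' v d (inflate u A) (inflate u B)"
proof (induction n arbitrary: a b c A B ws)
  case 0
  then show ?case using target_sound[of t a b c A B ws] by fastforce
next
  case (Suc n)
  show ?case
  proof (cases "target t a b c A B")
    case True
    then show ?thesis using target_sound[of t a b c A B ws] by fastforce
  next
    case False
    obtain x ws1 where ws: "ws = x # ws1" using Suc.prems(2) by (cases ws) auto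
    have "search n t b c x (inflate [a] A) (inflate [a] B)" using Suc.prems(1) False
      by (cases x) (auto split: if_splits)
    then obtain u ws' v d where u: "b # c # x # ws1 = u @ ws'" "length u \<le> n"
        "good_target t ws' v d (inflate u (inflate [a] A)) (inflate u (inflate [a] B))"
      using Suc.IH[of b c x "inflate [a] A" "inflate [a] B" ws1] Suc.prems(2) ws by auto
    then have "a # b # c # ws = (a # u) @ ws'"
      "good_target t ws' v d (inflate (a # u) A) (inflate (a # u) B)" by (auto simp: ws)
    then show ?thesis using u(2) by (metis Suc_le_mono length_Cons)
  qed
qed

lemma pneg_units: "d \<in> set units \<Longrightarrow> pneg d \<in> set units" by (auto simp: units_def)
lemma hor_pneg [simp]: "hor (pneg d) = hor d" by (cases d) (auto simp: hor_def)
lemma exceptional3_pneg: "exceptional3 (pneg d) = exceptional3 d"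
  by (auto simp: exceptional3_def fun_eq_iff)
lemma exceptional_pneg: "exceptional (pneg d) = exceptional d"
  by (auto simp: exceptional_def exceptional3_pneg fun_eq_iff)

lemma good_target_swap: "good_target t ws v d A B \<Longrightarrow> good_target t ws v (pneg d) B A"
  by (auto simp: good_target_def exceptional_pneg pneg_units)

lemma good_target_shift:
  assumes "good_target t ws v d A B"
  shows "good_target t ws (padd w v) d (map (shift w) A) (map (shift w) B)"
proof -
  have all: "\<forall>r\<in>set ring16. \<exists>g\<in>set A \<union> set B. mid g = padd (padd v v) r"
    using assms unfolding good_target_def by simp
  have "\<exists>g\<in>set (map (shift w) A) \<union>
    set (map (shift w) B). mid g = padd (padd (padd w v) (padd w v)) r"
    if r: "r \<in> set ring16" for r
  proof -
    obtain g where g: "g \<in> set A \<union> set B" "mid g = padd (padd v v) r" using all r by blast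
    have "mid (shift w g) = padd (padd (padd w v) (padd w v)) r"
      unfolding mid_shift g(2) by (cases w; cases v; cases r) simp
    then show ?thesis using g(1) by auto
  qed
  then show ?thesis using assms by (auto simp: good_target_def pass_shift map_mono_sublist)
qed

text \<open>Six levels and three signs of lookahead account for the length 9. The search was run for
  two directions at the origin: replacing \<open>d\<close> by \<open>pneg d\<close> exchanges the
  two pieces, and a translation moves the origin to \<open>v\<close>.\<close>

lemma ex_good_target:
  assumes "d \<in> set units" "\<not> exceptional d ws" "9 \<le> length ws"
  shows "\<exists>u ws' v' d'. ws = u @ ws' \<and> length u \<le> 6 \<and>
           good_target t ws' v' d' (inflate u (pass t v d)) (inflate u (pass t v (pneg d)))"
proof -
  obtain a b c r where ws: "ws = a # b # c # r"
    using assms(3) ex_Cons3[of ws] by auto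
  have e: "\<not> exceptional3 d a b c" using assms(2) by (auto simp: exceptional_def ws)
  have *: "\<exists>u ws' v' d'. ws = u @ ws' \<and> length u \<le> 6 \<and>
           good_target t ws' v' d' (inflate u (pass t (0,0) d)) (inflate u (pass t (0,0) (pneg d)))"
    if "d = (1, 0) \<or> d = (0, 1)" "\<not> exceptional3 d a b c" for d
  proof -
    have "search_all t d" using search_all_1 search_all_2 search_all_3 search_all_4 that(1)
      by (cases t) auto
    then have "search 6 t a b c (pass t (0,0) d) (pass t (0,0) (pneg d))"
      using that(2) bool_in_list unfolding search_all_def all_in_iff if_bool_eq_conj by blast
    from search_sound[OF this, of r] show ?thesis using assms(3) unfolding ws by simp
  qed
  consider "d = (1, 0) \<or> d = (0, 1)" | "pneg d = (1, 0) \<or> pneg d = (0, 1)" using assms(1)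
    by (auto simp: units_def)
  then have **: "\<exists>u ws' v' d'. ws = u @ ws' \<and> length u \<le> 6 \<and>
           good_target t ws' v' d' (inflate u (pass t (0,0) d)) (inflate u (pass t (0,0) (pneg d)))"
  proof cases
    case 1
    then show ?thesis using * e by blast
  next
    case 2
    then show ?thesis using *[of "pneg d"] e good_target_swap unfolding exceptional3_pneg pneg_pneg
      by meson
  qed
  then obtain u ws' v' d' where u: "ws = u @ ws'" "length u \<le> 6"
     "good_target t ws' v' d' (inflate u (pass t (0,0) d)) (inflate u (pass t (0,0) (pneg d)))"
       by blast
  have "inflate u (pass t v d) = map (shift ((mulT ^^ length u) v)) (inflate u (pass t (0,0) d))" for d
    using inflate_shift pass_shift[of t v "(0,0)" d] by simp
  then show ?thesis using u good_target_shift by metis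
qed

lemma loop_at_sound:
  "loop_at a b c L M \<Longrightarrow> \<exists>t v d. \<not> exceptional3 d a b c \<and> sublist (pass t v d) L \<and>
    sublist (pass t v (pneg d)) L"
proof (induction a b c L M rule: loop_at.induct)
  case (1 a b c L e0 e1 e2 e3 e4 e5 M)
  show ?case
  proof (cases "eq_pt (fst e1) (fst e5) \<and> \<not> exceptional3 (snd e0) a b c")
    case True
    then have "ex_in (\<lambda>t. if block2 (pass t (fst e1) (snd e0)) L
                   then block2 (pass t (fst e1) (pneg (snd e0))) L else False) [True, False]"
      using 1(3) by simp
    then obtain t where "block2 (pass t (fst e1) (snd e0)) L"
      "block2 (pass t (fst e1) (pneg (snd e0))) L"
      unfolding ex_in_iff if_bool_eq_conj by blast
    then show ?thesis using True block2_sublist by blast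
  next
    case False
    then show ?thesis using 1 by (auto split: if_splits)
  qed
qed auto

lemma search_loop_sound:
  "search_loop n a b c L \<Longrightarrow> n + 3 \<le> length (a # b # c # ws) \<Longrightarrow>
   \<exists>u ws' t v d. a # b # c # ws = u @ ws' \<and> length u \<le> n \<and> \<not> exceptional d ws' \<and>
     sublist (pass t v d) (inflate u L) \<and> sublist (pass t v (pneg d)) (inflate u L)"
proof (induction n arbitrary: a b c L ws)
  case 0
  then show ?case using loop_at_sound[of a b c L L] unfolding exceptional_def by fastforce
next
  case (Suc n)
  show ?case
  proof (cases "loop_at a b c L L")
    case True
    then show ?thesis using loop_at_sound[of a b c L L] unfolding exceptional_def by fastforce
  next
    case False
    obtain x ws1 where ws: "ws = x # ws1" using Suc.prems(2) by (cases ws) auto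
    have "search_loop n b c x (inflate [a] L)" using Suc.prems(1) False
      by (cases x) (auto split: if_splits)
    then obtain u ws' t v d where u: "b # c # x # ws1 = u @ ws'" "length u \<le> n"
      "\<not> exceptional d ws'"
        "sublist (pass t v d) (inflate u (inflate [a] L))"
          "sublist (pass t v (pneg d)) (inflate u (inflate [a] L))"
      using Suc.IH[of b c x "inflate [a] L" ws1] Suc.prems(2) ws by auto
    then have "a # b # c # ws = (a # u) @ ws'" "sublist (pass t v d) (inflate (a # u) L)"
      "sublist (pass t v (pneg d)) (inflate (a # u) L)"
      by (auto simp: ws)
    then show ?thesis using u(2,3) by (metis Suc_le_mono length_Cons)
  qed
qed

text \<open>This provides the first pair: both passages lie in one inflated segment. Five levels and
  three signs of lookahead account for the length 8.\<close>

lemma ex_loop: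
  assumes "d0 \<in> set units" "8 \<le> length ws"
  shows "\<exists>u ws' t v d. ws = u @ ws' \<and> length u \<le> 5 \<and> d \<in> set units \<and> \<not> exceptional d ws' \<and>
     sublist (pass t v d) (inflate u [((0,0), d0)]) \<and> sublist (pass t v (pneg d)) (inflate u [((0,0), d0)])"
proof -
  obtain a b c r where ws: "ws = a # b # c # r"
    using assms(2) ex_Cons3[of ws] by auto
  have "search_loop 5 a b c [((0,0), d0)]" using search_loop_all[OF assms(1)] bool_in_list
    unfolding search_loop_all_def all_in_iff by blast
  then obtain u ws' t v d where u: "ws = u @ ws'" "length u \<le> 5" "\<not> exceptional d ws'"
     "sublist (pass t v d) (inflate u [((0,0), d0)])"
       "sublist (pass t v (pneg d)) (inflate u [((0,0), d0)])"
    using search_loop_sound[of 5 a b c "[((0,0), d0)]" r] assms(2) unfolding ws by auto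
  \<comment> \<open>The search does not report that \<open>d\<close> is a unit; it is one because
    the passage consists of segments of an inflated list.\<close>
  have "oseg (hor d0) ((0,0), d0)" using assms(1) by (simp add: oseg_def)
  then have "\<forall>e\<in>set (inflate u [((0,0), d0)]). oseg (last (hor d0 # u)) e" using oseg_inflate
    by fastforce
  moreover have "set (pass t v d) \<subseteq> set (inflate u [((0,0), d0)])" using u(4) set_mono_sublist
    by blast
  ultimately have "d \<in> set units" by (auto simp: pass_def oseg_def)
  then show ?thesis using u by blast
qed

section \<open>Nested pairs of pieces\<close>

definition touch :: "iseg \<Rightarrow> iseg \<Rightarrow> bool" where
  "touch e f \<longleftrightarrow> {fst e, iend e} \<inter> {fst f, iend f} \<noteq> {}"

text \<open>The conditions on the ends prevent one list from being continued by the other.\<close>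

definition separate :: "bool \<Rightarrow> pt \<Rightarrow> iseg list \<Rightarrow> iseg list \<Rightarrow> bool" where
  "separate p w A B \<longleftrightarrow> (\<forall>e\<in>set A \<union> set B. oseg p e) \<and> set A \<inter> set B = {} \<and> A \<noteq> [] \<and> B \<noteq> [] \<and>
     iend (last A) \<noteq> fst (hd B) \<and> iend (last B) \<noteq> fst (hd A) \<and>
     (\<exists>e\<in>set A. iend e = w) \<and> (\<exists>e\<in>set B. iend e = w)"

text \<open>All lists consist of segments of the finest level; a larger \<open>j\<close> belongs to
  a coarser vertex. The bounds on the lengths reflect that one step goes up by at most six levels,
  and they confine stage \<open>j\<close> to a region depending on \<open>j\<close> alone.\<close>

definition nest :: "nat \<Rightarrow> bool \<Rightarrow> pt \<Rightarrow> (nat \<Rightarrow> iseg list) \<Rightarrow> (nat \<Rightarrow> iseg list) \<Rightarrow> bool" where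
  "nest k p w A B \<longleftrightarrow>
     (\<forall>j\<le>k. separate p w (A j) (B j) \<and> length (A j) \<le> 2 ^ (6 * j + 10) \<and> length (B j) \<le> 2 ^ (6 * j + 10)) \<and>
     (\<forall>j<k. sublist (A j) (A (Suc j)) \<and> sublist (B j) (B (Suc j)) \<and>
       (\<forall>e\<in>set (A j) \<union> set (B j). \<forall>f. oseg p f \<and> touch e f \<longrightarrow> f \<in> set (A (Suc j)) \<union> set (B (Suc j))))"

section \<open>Midpoints and passages around a vertex\<close>

lemma touch_near_seg:
  assumes "oseg p e" "oseg p f" "touch e f" shows "near_seg e f"
proof -
  obtain a b d a' b' d' where e: "e = ((a, b), d)" "f = ((a', b'), d')" by (metis surj_pair)
  obtain d1 d2 d1' d2' where d: "d = (d1, d2)" "d' = (d1', d2')" by (metis surj_pair)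
  have "\<bar>d1\<bar> + \<bar>d2\<bar> = 1" "\<bar>d1'\<bar> + \<bar>d2'\<bar> = 1"
    using assms l1_unit[of d] l1_unit[of d'] by (simp_all add: oseg_def e d l1_def)
  moreover have "a' = a \<and> b' = b \<or> a' = a + d1 \<and> b' = b + d2 \<or> a' + d1' = a \<and> b' + d2' = b \<or>
    a' + d1' = a + d1 \<and> b' + d2' = b + d2"
    using assms(3) unfolding touch_def e d iend_def by fastforce
  ultimately have "\<bar>2 * a' + d1' - (2 * a + d1)\<bar> + \<bar>2 * b' + d2' - (2 * b + d2)\<bar> \<le> 2"
    by (smt (verit))
  then show ?thesis by (simp add: near_seg_def l1_def mid_def e d algebra_simps)
qed

lemma ring16_iff:
  assumes "odd (a + b)" "\<bar>a\<bar> + \<bar>b\<bar> \<le> 3" shows "(a, b) \<in> set ring16"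
proof -
  have "a = -3 \<or> a = -2 \<or> a = -1 \<or> a = 0 \<or> a = 1 \<or> a = 2 \<or> a = 3"
    "b = -3 \<or> b = -2 \<or> b = -1 \<or> b = 0 \<or> b = 1 \<or> b = 2 \<or> b = 3"
    using assms(2) by presburger+
  then show ?thesis using assms by (elim disjE; simp add: ring16_def)
qed

lemma odd_unit: "d \<in> set units \<Longrightarrow> odd (fst d + snd d)"
  by (auto simp: units_def)

lemma quarter_units: "d \<in> set units \<Longrightarrow> quarter t d \<in> set units"
  by (cases t) (auto simp: units_def quarter_def)

lemma hor_quarter: "d \<in> set units \<Longrightarrow> hor (quarter t d) = (\<not> hor d)"
  by (cases t) (auto simp: units_def quarter_def hor_def)

lemma even_padd: "even (fst (padd v w) + snd (padd v w)) = (even (fst v + snd v) = even (fst w + snd w))"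
  by (cases v; cases w) (simp, presburger)

text \<open>Reversing a segment changes the parity of its start but not whether it is horizontal, so
  the convention admits one orientation of each interval.\<close>

lemma mid_inj:
  assumes "oseg p e" "oseg p f" "mid e = mid f" shows "e = f"
proof -
  obtain a b d a' b' d' where e: "e = ((a, b), d)" "f = ((a', b'), d')" by (metis surj_pair)
  have d: "d \<in> set units" "d' \<in> set units" using assms by (auto simp: oseg_def e)
  have m: "2 * a + fst d = 2 * a' + fst d'" "2 * b + snd d = 2 * b' + snd d'"
    using assms(3) by (cases d; cases d'; simp add: mid_def e)+
  have "even (snd d) = even (snd d')" using m(2) by presburger
  then have h: "hor d = hor d'" using d by (auto simp: units_def hor_def)
  then have "even (a + b) = even (a' + b')" using assms(1,2) by (auto simp: oseg_def e)
  moreover have "d = d'"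
  proof (rule ccontr)
    assume "d \<noteq> d'"
    then have "d' = pneg d" using h d by (auto simp: units_def hor_def)
    then have "a' + b' - a - b = fst d + snd d" using m by (cases d) auto
    moreover have "odd (fst d + snd d)" using odd_unit[OF d(1)] .
    ultimately show False using \<open>even (a + b) = even (a' + b')\<close> by presburger
  qed
  ultimately have "d = d'" by simp
  then show ?thesis using m e by auto
qed

lemma pass_oseg:
  assumes "d \<in> set units" "e \<in> set (pass t v d)"
  shows "oseg (even (fst v + snd v) = (\<not> hor d)) e"
proof -
  consider "e = (padd v (pneg d), d)" | "e = (v, quarter t d)" using assms(2) unfolding pass_def
    by auto
  then show ?thesis
  proof cases
    case 1
    then show ?thesis using odd_unit[OF pneg_units[OF assms(1)]] assms(1)
      unfolding oseg_def 1 fst_conv snd_conv even_padd by blast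
  next
    case 2
    then show ?thesis using quarter_units[OF assms(1)] hor_quarter[OF assms(1)]
      unfolding oseg_def 2 fst_conv snd_conv by blast
  qed
qed

lemma pass_neq_Nil: "pass t v d \<noteq> []"
  by (simp add: pass_def)

lemma mid_pass:
  assumes "d \<in> set units" "e \<in> set (pass t v d)"
  shows "\<exists>u\<in>set units. mid e = padd (padd v v) u"
proof -
  consider "e = (padd v (pneg d), d)" | "e = (v, quarter t d)" using assms(2) unfolding pass_def
    by auto
  then show ?thesis
  proof cases
    case 1
    then have "mid e = padd (padd v v) (pneg d)" by (cases v; cases d) (simp add: mid_def)
    then show ?thesis using pneg_units[OF assms(1)] by blast
  next
    case 2
    then show ?thesis using quarter_units[OF assms(1)] by (auto simp: mid_def)
  qed
qed

lemma quarter_neq: "d \<in> set units \<Longrightarrow> quarter t d \<noteq> d"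
  using hor_quarter[of d t] by auto

lemma mem_inflate: "g \<in> set (inflate ws L) \<longleftrightarrow> (\<exists>e\<in>set L. g \<in> set (inflate ws [e]))"
  by (subst set_inflate) simp

text \<open>Disjointness is inherited from the coarse level because ancestors are unique, and the
  conditions on the ends because inflation merely scales end points.\<close>

lemma separate_pass:
  fixes v d t
  assumes d: "d \<in> set units"
  defines "p \<equiv> (even (fst v + snd v) = (\<not> hor d))"
  shows "separate (last (p # ws)) ((mulT ^^ length ws) v) (inflate ws (pass t v d)) (inflate ws (pass t v (pneg d)))"
proof -
  have inj: "(mulT ^^ n) x = (mulT ^^ n) y \<longleftrightarrow> x = y" for n x y
  proof (induction n)
    case (Suc n)
    have "mulT a = mulT b \<longleftrightarrow> a = b" for a b by (cases a; cases b) auto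
    then show ?case using Suc by simp
  qed simp
  have o: "\<forall>e\<in>set (pass t v d) \<union> set (pass t v (pneg d)). oseg p e"
    using pass_oseg[OF d] pass_oseg[OF pneg_units[OF d]] by (auto simp: p_def)
  have dis: "set (pass t v d) \<inter> set (pass t v (pneg d)) = {}"
    using d by (cases v) (auto simp: pass_def quarter_def units_def)
  have "set (inflate ws (pass t v d)) \<inter> set (inflate ws (pass t v (pneg d))) = {}"
  proof (rule ccontr)
    assume "\<not> ?thesis"
    then obtain g where "g \<in> set (inflate ws (pass t v d))"
      "g \<in> set (inflate ws (pass t v (pneg d)))" by blast
    then obtain e f where "e \<in> set (pass t v d)" "f \<in> set (pass t v (pneg d))"
      "g \<in> set (inflate ws [e])" "g \<in> set (inflate ws [f])"
      unfolding mem_inflate[of _ _ "pass _ _ _"] by blast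
    then show False using unique_ancestor[of p e f g ws] o dis by blast
  qed
  moreover have "\<forall>e\<in>set (inflate ws (pass t v d)) \<union>
    set (inflate ws (pass t v (pneg d))). oseg (last (p # ws)) e"
    using oseg_inflate o by blast
  moreover have ex: "\<exists>e\<in>set (inflate ws (pass t v d)). iend e = (mulT ^^ length ws) v" for d
  proof -
    let ?e = "(padd v (pneg d), d)"
    have "iend ?e = v" by (simp add: iend_def padd_assoc)
    then have "iend (last (inflate ws [?e])) = (mulT ^^ length ws) v" using inflate_ends[of ws ?e]
      by simp
    moreover have "last (inflate ws [?e]) \<in> set (inflate ws (pass t v d))"
      unfolding mem_inflate[of _ _ "pass _ _ _"]
        by (rule bexI[of _ ?e]) (simp_all add: pass_def inflate_neq_Nil)
    ultimately show ?thesis by blast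
  qed
  moreover have "iend (last (pass t v d)) \<noteq> fst (hd (pass t v (pneg d)))"
    "iend (last (pass t v (pneg d))) \<noteq> fst (hd (pass t v d))"
    using quarter_neq[OF d, of t] quarter_neq[OF pneg_units[OF d], of t]
      by (simp_all add: pass_def iend_def padd_cancel)
  ultimately show ?thesis
    using ex[of d] ex[of "pneg d"] pass_neq_Nil
    unfolding separate_def by (simp add: inflate_neq_Nil inflate_hd_last inj)
qed

text \<open>As \<open>e\<close> and \<open>f\<close> touch, their ancestors \<open>e1\<close> and
  \<open>f1\<close> are near each other. The doubled midpoint of \<open>e1\<close> has distance 1
  from the doubled vertex, so that of \<open>f1\<close> has distance at most 3. Thus
  \<open>f1\<close> is one of the sixteen segments, all of which belong to \<open>A\<close> or
  \<open>B\<close>.\<close>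

lemma interior:
  assumes "good_target t ws v d A B" "\<forall>e\<in>set A \<union> set B. oseg p e"
    and e: "e \<in> set (inflate ws (pass t v d)) \<union> set (inflate ws (pass t v (pneg d)))"
    and f: "oseg (last (p # ws)) f" "touch e f"
  shows "f \<in> set (inflate ws A) \<union> set (inflate ws B)"
proof -
  have gt: "d \<in> set units" "sublist (pass t v d) A" "sublist (pass t v (pneg d)) B"
     "\<forall>r\<in>set ring16. \<exists>g\<in>set A \<union> set B. mid g = padd (padd v v) r"
    using assms(1) unfolding good_target_def by simp_all
  obtain e1 where e1: "e1 \<in> set (pass t v d) \<union> set (pass t v (pneg d))" "e \<in> set (inflate ws [e1])"
    using e unfolding Un_iff mem_inflate[of _ _ "pass _ _ _"] by blast
  have "oseg p e1" using e1(1) gt(2,3) assms(2) set_mono_sublist by blast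
  obtain f1 where f1: "oseg p f1" "f \<in> set (inflate ws [f1])" using oseg_ancestor[OF f(1)] by blast
  have "oseg (last (p # ws)) e" using oseg_inflate[of "[e1]" p e ws] e1 \<open>oseg p e1\<close> by simp
  then have "near_seg e f" using touch_near_seg f by blast
  then have near_seg: "near_seg e1 f1" using near_seg_ancestor[OF \<open>oseg p e1\<close> f1(1) e1(2) f1(2)]
    by blast
  obtain a b where ab: "padd (mid f1) (pneg (padd v v)) = (a, b)" by fastforce
  then have mf: "mid f1 = padd (padd v v) (a, b)"
    by (metis padd_assoc padd_commute padd_pneg(1) padd_0(2))
  have "odd (fst (mid f1) + snd (mid f1))" using f1(1)
    by (cases "fst f1"; cases "snd f1") (auto simp: mid_def oseg_def units_def)
  then have "odd (a + b)" unfolding mf by (cases v) auto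
  moreover have "\<bar>a\<bar> + \<bar>b\<bar> \<le> 3"
  proof -
    obtain x y where xy: "mid e1 = padd (padd v v) (x, y)" "\<bar>x\<bar> + \<bar>y\<bar> = 1"
    proof -
      obtain u where "u \<in> set units" "mid e1 = padd (padd v v) u"
        using e1(1) mid_pass gt(1) pneg_units by blast
      then show thesis using that[of "fst u" "snd u"] l1_unit[of u] by (simp add: l1_def)
    qed
    have "padd (mid f1) (pneg (mid e1)) = (a - x, b - y)" unfolding xy mf by (cases v) simp
    then have "\<bar>a - x\<bar> + \<bar>b - y\<bar> \<le> 2" using near_seg by (simp add: near_seg_def l1_def)
    then show ?thesis using xy(2) by (smt (verit))
  qed
  ultimately have "(a, b) \<in> set ring16" by (rule ring16_iff)
  then obtain g where "g \<in> set A \<union> set B" "mid g = mid f1" using gt(4) mf by metis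
  then have "f1 \<in> set A \<union> set B" using mid_inj[of p g f1] assms(2) f1(1) by blast
  then show ?thesis using f1(2) unfolding Un_iff mem_inflate[of _ _ A] mem_inflate[of _ _ B]
    by blast
qed

text \<open>A search cuts a prefix \<open>u\<close> off the word and finds a finer vertex whose pair
  lies inside the present one. The induction hypothesis supplies the nest up to that pair, and the
  present pair is put around it. At most six signs are lost per step and at most nine are left at
  the end, so long words give large \<open>k\<close>.\<close>

lemma ex_nest:
  assumes "d \<in> set units" "\<not> exceptional d ws"
  defines "p \<equiv> (\<lambda>v d. even (fst v + snd v) = (\<not> hor d))"
  shows "\<exists>k A B w. nest k (last (p v d # ws)) w A B \<and> length ws \<le> 6 * k + 9 \<and>
           A k = inflate ws (pass t v d) \<and> B k = inflate ws (pass t v (pneg d))"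
  using assms(1,2)
proof (induction ws arbitrary: v d rule: length_induct)
  case (1 ws)
  have len: "length (inflate ws (pass t v d)) = 2 ^ length ws * 2" for d ws v
    by (simp add: length_inflate pass_def)
  show ?case
  proof (cases "length ws \<le> 9")
    case True
    have "2 ^ length ws * 2 \<le> (2 :: nat) ^ 9 * 2" using True
      by (intro mult_right_mono power_increasing) auto
    then have "nest 0 (last (p v d # ws)) ((mulT ^^ length ws) v) (\<lambda>_. inflate ws (pass t v d)) (\<lambda>_. inflate ws (pass t v (pneg d)))"
      using separate_pass[OF 1(2), of v ws t] by (simp add: nest_def len p_def)
    then show ?thesis using True by (intro exI[of _ 0] exI) auto
  next
    case False
    obtain u ws' v' d' where u: "ws = u @ ws'" "length u \<le> 6"
      "good_target t ws' v' d' (inflate u (pass t v d)) (inflate u (pass t v (pneg d)))"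
      using ex_good_target[OF 1(2,3), where v = v and t = t] False by auto
    have gt: "d' \<in> set units" "\<not> exceptional d' ws'"
      "sublist (pass t v' d') (inflate u (pass t v d))"
      "sublist (pass t v' (pneg d')) (inflate u (pass t v (pneg d)))"
      using u(3) unfolding good_target_def by simp_all
    let ?p = "last (p v d # u)"
    have op: "\<forall>e\<in>set (inflate u (pass t v d)) \<union> set (inflate u (pass t v (pneg d))). oseg ?p e"
      using separate_pass[OF 1(2), of v u t] by (simp add: separate_def p_def)
    have pp: "p v' d' = ?p"
    proof -
      have "(v', quarter t d') \<in> set (inflate u (pass t v d))" using gt(3) set_mono_sublist
        by (fastforce simp: pass_def)
      then have "oseg ?p (v', quarter t d')" using op by blast
      then show ?thesis using pass_oseg[OF gt(1), of "(v', quarter t d')" t v']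
        by (auto simp: p_def pass_def oseg_def)
    qed
    then have lst: "last (p v' d' # ws') = last (p v d # ws)" by (simp add: u(1) last_append)
    \<comment> \<open>Sixteen positions cannot be covered by the four segments of the two
      passages.\<close>
    have "u \<noteq> []"
    proof
      assume "u = []"
      have "\<exists>g\<in>set (pass t v d) \<union> set (pass t v (pneg d)). mid g = padd (padd v' v') r"
        if "r \<in> set ring16" for r
        using that u(3) \<open>u = []\<close> unfolding good_target_def by simp
      then have "padd (padd v' v') ` set ring16 \<subseteq> mid ` (set (pass t v d) \<union>
        set (pass t v (pneg d)))" by force
      then have "card (padd (padd v' v') ` set ring16) \<le> card (mid ` (set (pass t v d) \<union>
        set (pass t v (pneg d))))"
        by (intro card_mono) auto
      also have "\<dots> \<le> card (set (pass t v d) \<union> set (pass t v (pneg d)))"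
        by (intro card_image_le) auto
      also have "\<dots> \<le> 2 + 2"
        by (intro card_Un_le[THEN order_trans] add_mono) (auto simp: pass_def card_insert_if)
      finally have "card (padd (padd v' v') ` set ring16) \<le> 4" by simp
      moreover have "card (padd (padd v' v') ` set ring16) = card (set ring16)"
        by (intro card_image inj_onI) (auto simp: padd_cancel)
      moreover have "card (set ring16) = 16" by (simp add: ring16_def)
      ultimately show False by simp
    qed
    then have less: "length ws' < length ws" by (simp add: u(1))
    obtain k A B w where n: "nest k (last (p v d # ws)) w A B" "length ws' \<le> 6 * k + 9"
      "A k = inflate ws' (pass t v' d')" "B k = inflate ws' (pass t v' (pneg d'))"
      using 1(1)[rule_format, OF less gt(1,2), of v'] unfolding lst by blast
    define A' where "A' = A(Suc k := inflate ws (pass t v d))"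
    define B' where "B' = B(Suc k := inflate ws (pass t v (pneg d)))"
    have ws: "inflate ws L = inflate ws' (inflate u L)" for L
      by (simp add: u(1) inflate_append_word)
    have sub: "sublist (A k) (A' (Suc k))" "sublist (B k) (B' (Suc k))"
      using gt(3,4) by (simp_all add: A'_def B'_def ws n sublist_inflate)
    \<comment> \<open>\<open>w\<close> stays the vertex of the innermost pair, whose segments
      persist in all larger pairs.\<close>
    have "separate (last (p v d # ws)) w (A' (Suc k)) (B' (Suc k))"
    proof -
      have "separate (last (p v d # ws)) w (A k) (B k)" using n(1) by (simp add: nest_def)
      moreover have "set (A k) \<subseteq> set (A' (Suc k))" "set (B k) \<subseteq> set (B' (Suc k))"
        using sub set_mono_sublist by blast+
      ultimately show ?thesis using separate_pass[OF 1(2), of v ws t]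
        unfolding separate_def A'_def B'_def p_def
        by (simp add: subset_eq) metis
    qed
    moreover have "length (A' (Suc k)) \<le> 2 ^ (6 * Suc k + 10)"
      "length (B' (Suc k)) \<le> 2 ^ (6 * Suc k + 10)"
    proof -
      have "length ws \<le> 6 * Suc k + 9" using u n(2) by simp
      then have "2 ^ Suc (length ws) \<le> (2::nat) ^ (6 * Suc k + 10)" by (intro power_increasing) auto
      then have "length (inflate ws (pass t v d)) \<le> 2 ^ (6 * Suc k + 10)" for d unfolding len
        by (simp only: power_Suc mult.commute)
      then show "length (A' (Suc k)) \<le> 2 ^ (6 * Suc k + 10)"
        "length (B' (Suc k)) \<le> 2 ^ (6 * Suc k + 10)"
        unfolding A'_def B'_def fun_upd_same by blast+
    qed
    moreover have "f \<in> set (A' (Suc k)) \<union> set (B' (Suc k))"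
      if "e \<in> set (A k) \<union> set (B k)" "oseg (last (p v d # ws)) f" "touch e f" for e f
      using interior[OF u(3) op, of e f] that lst pp unfolding n(3,4) A'_def B'_def ws[symmetric]
        by simp
    ultimately have "nest (Suc k) (last (p v d # ws)) w A' B'"
      using n(1) sub unfolding nest_def less_Suc_eq le_Suc_eq
      by (auto simp: A'_def B'_def)
    moreover have "length ws \<le> 6 * Suc k + 9" using u n(2) by simp
    moreover have "A' (Suc k) = inflate ws (pass t v d)"
      "B' (Suc k) = inflate ws (pass t v (pneg d))"
      by (simp_all only: A'_def B'_def fun_upd_same)
    ultimately show ?thesis by blast
  qed
qed

section \<open>Folding sequences\<close>

definition sgn_of :: "bool \<Rightarrow> int" where "sgn_of t = (if t then 1 else - 1)"

lemma fold_bar_simps: "fold_bar (S @ T) = fold_bar T @ fold_bar S"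
  "fold_bar (e # S) = fold_bar S @ [- e]" "fold_bar [] = []"
  by (simp_all add: fold_bar_def)

lemma fold_bar_idem [simp]: "fold_bar (fold_bar S) = S" by (simp add: fold_bar_def rev_map comp_def)

lemma length_fold_bar [simp]: "length (fold_bar S) = length S" by (simp add: fold_bar_def)

text \<open>So the turns along the two legs, before and after the middle turn, are exchanged by
  \<open>fold_bar\<close>, exactly as in a folding sequence.\<close>

lemma fold_bar_turns: "fold_bar (map sgn_of (turns ws h)) = map sgn_of (turns ws (\<not> h))"
proof (induction ws arbitrary: h)
  case (Cons s ws)
  have "- sgn_of (s = h) = sgn_of (s = (\<not> h))" by (cases s; cases h) (simp_all add: sgn_of_def)
  then show ?case by (simp add: fold_bar_simps Cons)
qed (simp add: fold_bar_simps)

text \<open>A quarter rotation of the plane exchanges horizontal and vertical segments and leaves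
  all turns as they are.\<close>

lemma turns_flip: "turns (map Not ws) (\<not> h) = turns ws h"
proof (induction ws arbitrary: h)
  case (Cons s ws)
  have "turns (map Not ws) s = turns ws (\<not> s)" for s using Cons[of "\<not> s"] by simp
  then show ?case by auto
qed simp

lemma folding_turns: "folding_seq n S \<Longrightarrow> \<exists>ws. length ws = n \<and> S = map sgn_of (turns ws h)"
proof (induction arbitrary: h rule: folding_seq.induct)
  case (Suc n S e)
  obtain s where e: "e = sgn_of (s = h)" using Suc.hyps(2) by (metis insertE singletonD sgn_of_def)
  obtain ws where "length ws = n" "S = map sgn_of (turns ws (\<not> s))" using Suc.IH by blast
  moreover from this have "fold_bar S = map sgn_of (turns ws s)" using fold_bar_turns[of ws "\<not> s"]
    by simp
  ultimately show ?case by (intro exI[of _ "s # ws"]) (simp add: e)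
qed auto

text \<open>The free choice of \<open>l\<close> serves to match a given curve: the last sign decides
  whether the first fine segment is horizontal.\<close>

lemma folding_turns_last:
  assumes "folding_seq n S" "0 < n"
  shows "\<exists>ws h. length ws = n \<and> S = map sgn_of (turns ws h) \<and> last ws = l"
proof -
  obtain ws where ws: "length ws = n" "S = map sgn_of (turns ws True)"
    using folding_turns[OF assms(1)] by blast
  show ?thesis
  proof (cases "last ws = l")
    case False
    have "ws \<noteq> []" using ws assms(2) by auto
    then have "last (map Not ws) = l" using False by (simp add: last_map)
    then show ?thesis using ws turns_flip[of ws True]
      by (intro exI[of _ "map Not ws"] exI[of _ "\<not> True"]) simp
  qed (use ws in blast)
qed

lemma folding_length: "folding_seq n S \<Longrightarrow> length S = 2 ^ n - 1"
proof (induction rule: folding_seq.induct)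
  case (Suc n S e)
  have "(1::nat) \<le> 2 ^ n" by simp
  then show ?case using Suc.IH by simp
qed simp

lemma folding_bar: "folding_seq n S \<Longrightarrow> folding_seq n (fold_bar S)"
proof (induction rule: folding_seq.induct)
  case (Suc n S e)
  have "- e \<in> {1, -1}" using Suc.hyps(2) by auto
  then show ?case using folding_seq.Suc[OF Suc.hyps(1), of "- e"] by (simp add: fold_bar_simps)
qed (simp add: fold_bar_simps folding_seq.zero)

lemma folding_ends:
  "folding_seq N S \<Longrightarrow> n \<le> N \<Longrightarrow> (\<exists>X Y. S = X @ Y \<and> folding_seq n X) \<and> (\<exists>X Y. S = X @ Y \<and>
    folding_seq n Y)"
proof (induction rule: folding_seq.induct)
  case (Suc N S e)
  show ?case
  proof (cases "n = Suc N")
    case True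
    then show ?thesis using folding_seq.Suc[OF Suc.hyps] by (metis append_Nil2 append_Nil)
  next
    case False
    then obtain X Y where XY: "S = X @ Y" "folding_seq n Y" using Suc by force
    then have "fold_bar S = fold_bar Y @ fold_bar X" by (simp add: fold_bar_simps)
    moreover have "folding_seq n (fold_bar Y)" using XY folding_bar by blast
    ultimately show ?thesis using XY(1,2) by (metis append.assoc append_Cons)
  qed
qed (auto intro: folding_seq.zero)

text \<open>A block containing the middle term has at least \<open>2 ^ n - 1\<close> terms on one
  side of it, and the half on that side begins or ends at the middle with an
  \<open>n\<close>-folding sequence. Any other block lies in one half, which is a folding sequence
  of lower order.\<close>

lemma folding_block:
  "folding_seq N S \<Longrightarrow> sublist W S \<Longrightarrow> 2 ^ Suc n - 1 \<le> length W \<Longrightarrow> \<exists>X. folding_seq n X \<and> sublist X W"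
proof (induction N arbitrary: S W)
  case 0
  then have "length W \<le> 0" using folding_length[OF 0(1)] sublist_length_le by fastforce
  moreover obtain m where "(2::nat) ^ n = Suc m" using gr0_implies_Suc[of "(2::nat) ^ n"] by auto
  ultimately show ?case using 0(3) by simp
next
  case (Suc N)
  obtain T e where S: "S = fold_bar T @ e # T" "folding_seq N T" using Suc.prems(1)
    by (cases rule: folding_seq.cases) auto
  have one: "(1::nat) \<le> 2 ^ n" "(1::nat) \<le> 2 ^ N" by simp_all
  have "length W \<le> 2 ^ Suc N - 1"
    using folding_length[OF Suc.prems(1)] sublist_length_le Suc.prems(2) by metis
  then have "(2::nat) ^ Suc n - 1 \<le> 2 ^ Suc N - 1" using Suc.prems(3) by (rule order_trans[rotated])
  then have "(2::nat) ^ Suc n \<le> 2 ^ Suc N" using le_diff_iff[of 1 "2 ^ Suc n"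
    "2 ^ Suc N"] one_le_power[of "2::nat"] by simp
  then have nN: "n \<le> N" using power_le_imp_le_exp[of 2 "Suc n" "Suc N"] by simp
  consider "sublist W (fold_bar T)" | "sublist W T"
    | X Y where "W = X @ e # Y" "suffix X (fold_bar T)" "prefix Y T"
  proof -
    note that1 = that(1) and that2 = that(2) and that3 = that(3)
    have "sublist W (fold_bar T) \<or> sublist W (e # T) \<or> (\<exists>X Y. W = X @ Y \<and> suffix X (fold_bar T) \<and>
      prefix Y (e # T))"
      using Suc.prems(2) unfolding S(1) sublist_append by blast
    moreover have "W = [] \<Longrightarrow> False" using Suc.prems(3) one by auto
    moreover have thesis if pr: "prefix Y (e # T)" "W = X @ Y" "suffix X (fold_bar T)" for X Y
    proof (cases Y)
      case Nil
      then show ?thesis using pr that1 suffix_imp_sublist by simp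
    next
      case (Cons a Y')
      then show ?thesis using pr that3 by simp
    qed
    ultimately show thesis using that1 that2 unfolding sublist_Cons_right
      by (metis append_Nil suffix_bot.bot_least)
  qed
  then show ?case
  proof cases
    case 1
    then show ?thesis using Suc.IH[OF folding_bar[OF S(2)]] Suc.prems(3) by blast
  next
    case 2
    then show ?thesis using Suc.IH[OF S(2)] Suc.prems(3) by blast
  next
    case (3 X Y)
    have "2 ^ n - 1 \<le> length X \<or> 2 ^ n - 1 \<le> length Y" using Suc.prems(3) one 3(1) by auto
    then show ?thesis
    proof
      assume l: "2 ^ n - 1 \<le> length Y"
      obtain P Q where PQ: "T = P @ Q" "folding_seq n P" using folding_ends[OF S(2) nN] by blast
      then have "length P \<le> length Y" using l folding_length by simp
      then have "prefix P Y" using 3(3) PQ(1) by (meson prefixI prefix_length_prefix)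
      then have "sublist P W" unfolding 3(1)
        by (metis prefix_imp_sublist sublist_Cons_right sublist_append sublist_order.dual_order.trans)
      then show ?thesis using PQ(2) by blast
    next
      assume l: "2 ^ n - 1 \<le> length X"
      obtain P Q where PQ: "fold_bar T = P @ Q" "folding_seq n Q"
        using folding_ends[OF folding_bar[OF S(2)] nN] by blast
      then have "length Q \<le> length X" using l folding_length by simp
      then have "suffix Q X" using suffix_length_suffix[OF suffixI[OF PQ(1)] 3(2)] by simp
      then have "sublist Q W" unfolding 3(1) by (metis suffix_imp_sublist sublist_append)
      then show ?thesis using PQ(2) by blast
    qed
  qed
qed

section \<open>Curves determined by signs\<close>

text \<open>The value \<open>True\<close> of \<open>\<sigma>\<close> at a lattice point stands for the turn \<open>+1\<close>.\<close>

definition nxt :: "(pt \<Rightarrow> bool) \<Rightarrow> iseg \<Rightarrow> iseg" where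
  "nxt \<sigma> e = (iend e, quarter (\<sigma> (iend e)) (snd e))"

definition prv :: "(pt \<Rightarrow> bool) \<Rightarrow> iseg \<Rightarrow> iseg" where
  "prv \<sigma> e = (let d = quarter (\<not> \<sigma> (fst e)) (snd e) in (padd (fst e) (pneg d), d))"

abbreviation chain :: "(pt \<Rightarrow> bool) \<Rightarrow> iseg list \<Rightarrow> bool" where
  "chain \<sigma> \<equiv> successively (\<lambda>e f. f = nxt \<sigma> e)"

lemma quarter_quarter [simp]: "quarter (\<not> t) (quarter t d) = d" "quarter t (quarter (\<not> t) d) = d"
  by (cases d; cases t; simp add: quarter_def)+

lemma nxt_prv [simp]: "nxt \<sigma> (prv \<sigma> e) = e"
  by (cases e) (simp add: nxt_def prv_def Let_def iend_def padd_assoc)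

lemma prv_nxt [simp]: "prv \<sigma> (nxt \<sigma> e) = e"
  by (cases e) (simp add: nxt_def prv_def Let_def iend_def padd_assoc)

lemma inj_nxt: "nxt \<sigma> e = nxt \<sigma> f \<longleftrightarrow> e = f"
  by (metis prv_nxt)

lemma oseg_nxt: assumes "oseg p e" shows "oseg p (nxt \<sigma> e)"
proof -
  have d: "snd e \<in> set units" using assms by (simp add: oseg_def)
  show ?thesis using assms odd_unit[OF d] quarter_units[OF d] hor_quarter[OF d]
    unfolding oseg_def nxt_def iend_def fst_conv snd_conv even_padd by blast
qed

lemma oseg_prv: assumes "oseg p e" shows "oseg p (prv \<sigma> e)"
proof -
  have d: "snd e \<in> set units" using assms by (simp add: oseg_def)
  let ?d = "quarter (\<not> \<sigma> (fst e)) (snd e)"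
  show ?thesis using assms odd_unit[OF pneg_units[OF quarter_units[OF d]]] quarter_units[OF d] hor_quarter[OF d]
    unfolding oseg_def prv_def Let_def fst_conv snd_conv even_padd by blast
qed

section \<open>Orbits and chains of the successor map\<close>

definition orbit :: "(pt \<Rightarrow> bool) \<Rightarrow> iseg \<Rightarrow> int \<Rightarrow> iseg" where
  "orbit \<sigma> e k = (if 0 \<le> k then (nxt \<sigma> ^^ nat k) e else (prv \<sigma> ^^ nat (- k)) e)"

lemma orbit_0 [simp]: "orbit \<sigma> e 0 = e" by (simp add: orbit_def)

lemma orbit_Suc: "orbit \<sigma> e (k + 1) = nxt \<sigma> (orbit \<sigma> e k)"
proof (cases "0 \<le> k")
  case True
  then have "nat (k + 1) = Suc (nat k)" by simp
  then show ?thesis using True by (simp add: orbit_def)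
next
  case False
  then have "nat (- k) = Suc (nat (- (k + 1)))" by simp
  then show ?thesis using False by (simp add: orbit_def)
qed

lemma orbit_add_nat: "orbit \<sigma> e (k + int n) = (nxt \<sigma> ^^ n) (orbit \<sigma> e k)"
proof (induction n)
  case (Suc n)
  have "orbit \<sigma> e (k + int (Suc n)) = nxt \<sigma> (orbit \<sigma> e (k + int n))"
    using orbit_Suc[of \<sigma> e "k + int n"] by (simp add: algebra_simps)
  then show ?case using Suc by simp
qed simp

lemma orbit_oseg: "oseg p e \<Longrightarrow> oseg p (orbit \<sigma> e k)"
proof -
  assume e: "oseg p e"
  have "oseg p ((nxt \<sigma> ^^ n) e)" "oseg p ((prv \<sigma> ^^ n) e)" for n
    by (induction n) (simp_all add: e oseg_nxt oseg_prv)
  then show ?thesis by (simp add: orbit_def)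
qed

lemma chain_nth: "chain \<sigma> L \<Longrightarrow> i + n < length L \<Longrightarrow> L ! (i + n) = (nxt \<sigma> ^^ n) (L ! i)"
proof (induction n)
  case (Suc n)
  then have "L ! Suc (i + n) = nxt \<sigma> (L ! (i + n))" by (simp add: successively_conv_nth)
  then show ?case using Suc by simp
qed simp

lemma chain_connected:
  assumes "chain \<sigma> L" "e \<in> set L" "f \<in> set L"
  shows "\<exists>k. f = orbit \<sigma> e k \<and> \<bar>k\<bar> < int (length L)"
proof -
  obtain i j where ij: "i < length L" "e = L ! i" "j < length L" "f = L ! j" using assms(2,3)
    by (metis in_set_conv_nth)
  show ?thesis
  proof (cases "i \<le> j")
    case True
    then have "f = (nxt \<sigma> ^^ (j - i)) e" using chain_nth[OF assms(1), of i "j - i"] ij by simp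
    then have "f = orbit \<sigma> e (int (j - i))" using orbit_add_nat[of \<sigma> e 0 "j - i"] by simp
    then show ?thesis using ij by (intro exI[of _ "int (j - i)"]) auto
  next
    case False
    then have "e = (nxt \<sigma> ^^ (i - j)) f" using chain_nth[OF assms(1), of j "i - j"] ij by simp
    moreover have "(nxt \<sigma> ^^ n) (orbit \<sigma> e (- int n)) = e" for n
      using orbit_add_nat[of \<sigma> e "- int n" n] by simp
    moreover have "inj (nxt \<sigma> ^^ n)" for n by (induction n) (auto simp: inj_compose inj_def inj_nxt)
    ultimately have "f = orbit \<sigma> e (- int (i - j))" by (metis injD)
    then show ?thesis using ij False by (intro exI[of _ "- int (i - j)"]) auto
  qed
qed

lemma nest_mono:
  assumes "nest k p w A B" "i \<le> j" "j \<le> k"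
  shows "sublist (A i) (A j) \<and> sublist (B i) (B j)"
  using assms(2,3)
proof (induction j rule: dec_induct)
  case (step j)
  then have "sublist (A j) (A (Suc j))" "sublist (B j) (B (Suc j))" using assms(1)
    by (auto simp: nest_def)
  then show ?case using step by (meson Suc_leD sublist_order.order.trans)
qed simp

lemma chain_sublist: "chain \<sigma> L \<Longrightarrow> sublist X L \<Longrightarrow> chain \<sigma> X"
  by (auto simp: sublist_def successively_append_iff)

text \<open>The common vertex is placed at the origin, so that these conditions can be imposed on
  translates of a covering and survive in a limit.\<close>

definition two_ended :: "nat \<Rightarrow> bool \<Rightarrow> (pt \<Rightarrow> bool) \<Rightarrow> bool" where
  "two_ended r p \<sigma> \<longleftrightarrow> (\<exists>A B. nest r p (0, 0) A B \<and> chain \<sigma> (A r) \<and> chain \<sigma> (B r))"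

lemma l1_triangle: "l1 (padd a b) \<le> l1 a + l1 b" by (cases a; cases b) (simp add: l1_def)

lemma chain_l1:
  assumes "chain \<sigma> L" "\<forall>e\<in>set L. oseg p e" "i + n < length L"
  shows "l1 (padd (iend (L ! (i + n))) (pneg (iend (L ! i)))) \<le> int n"
  using assms(3)
proof (induction n)
  case 0
  then show ?case by (simp add: l1_def)
next
  case (Suc n)
  let ?e = "L ! (i + n)" and ?f = "L ! (i + Suc n)"
  have "?f = nxt \<sigma> ?e" using assms(1) Suc.prems by (simp add: successively_conv_nth)
  then have "iend ?f = padd (iend ?e) (snd ?f)" by (simp add: nxt_def iend_def)
  then have "padd (iend ?f) (pneg (iend (L ! i))) = padd (snd ?f) (padd (iend ?e) (pneg (iend (L ! i))))"
    by (simp only: padd_commute[of "iend ?e" "snd ?f"] padd_assoc)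
  moreover have "oseg p ?f" using assms(2) Suc.prems by (meson nth_mem)
  then have "l1 (snd ?f) = 1" by (intro l1_unit) (simp add: oseg_def)
  ultimately show ?case using l1_triangle[of "snd ?f" "padd (iend ?e) (pneg (iend (L ! i)))"] Suc
    by simp
qed

lemma l1_pneg [simp]: "l1 (pneg a) = l1 a" by (cases a) (simp add: l1_def)

lemma chain_bounded:
  assumes "chain \<sigma> L" "\<forall>e\<in>set L. oseg p e" "e \<in> set L" "iend e = (0, 0)" "f \<in> set L"
  shows "l1 (iend f) \<le> int (length L)"
proof -
  obtain i j where ij: "i < length L" "e = L ! i" "j < length L" "f = L ! j" using assms(3,5)
    by (metis in_set_conv_nth)
  show ?thesis
  proof (cases "i \<le> j")
    case True
    then show ?thesis using chain_l1[OF assms(1,2), of i "j - i"] ij assms(4) by simp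
  next
    case False
    then show ?thesis using chain_l1[OF assms(1,2), of j "i - j"] ij assms(4) by simp
  qed
qed

text \<open>A chain through the origin with at most \<open>2 ^ (6 * r + 10)\<close> segments stays
  in the l1 ball of this radius, so only finitely many signs are involved.\<close>

lemma two_ended_local:
  assumes "two_ended r p \<sigma>" "\<And>z. l1 z \<le> 2 ^ (6 * r + 10) \<Longrightarrow> \<sigma> z = \<sigma>' z"
  shows "two_ended r p \<sigma>'"
proof -
  obtain A B where n: "nest r p (0, 0) A B" and ch: "chain \<sigma> (A r)" "chain \<sigma> (B r)" using assms(1)
    by (auto simp: two_ended_def)
  have transfer: "chain \<sigma>' L" if "chain \<sigma> L" "\<forall>e\<in>set L. oseg p e" "\<exists>e\<in>set L. iend e = (0, 0)"
    "length L \<le> 2 ^ (6 * r + 10)" for L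
  proof -
    have "nxt \<sigma>' f = nxt \<sigma> f" if "f \<in> set L" for f
    proof -
      obtain e where "e \<in> set L" "iend e = (0, 0)" using \<open>\<exists>e\<in>set L. iend e = (0, 0)\<close> by blast
      then have "l1 (iend f) \<le> int (length L)"
        using chain_bounded \<open>chain \<sigma> L\<close> \<open>\<forall>e\<in>set L. oseg p e\<close> \<open>f \<in> set L\<close> by blast
      also have "\<dots> \<le> int (2 ^ (6 * r + 10))" using \<open>length L \<le> _\<close> by (simp only: of_nat_le_iff)
      finally have "\<sigma> (iend f) = \<sigma>' (iend f)" using assms(2) by simp
      then show ?thesis by (simp add: nxt_def)
    qed
    then show ?thesis using \<open>chain \<sigma> L\<close> by (auto intro: successively_mono)
  qed
  have "separate p (0, 0) (A r) (B r)" "length (A r) \<le> 2 ^ (6 * r + 10)"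
    "length (B r) \<le> 2 ^ (6 * r + 10)"
    using n unfolding nest_def by blast+
  then have "chain \<sigma>' (A r)" "chain \<sigma>' (B r)" using transfer ch unfolding separate_def by blast+
  then show ?thesis using n by (auto simp: two_ended_def)
qed

lemma nest_touch:
  "nest r p w A B \<Longrightarrow> j < r \<Longrightarrow> e \<in> set (A j) \<union> set (B j) \<Longrightarrow> oseg p f \<Longrightarrow> touch e f \<Longrightarrow>
   f \<in> set (A (Suc j)) \<union> set (B (Suc j))"
  unfolding nest_def by blast

text \<open>Going from the origin to \<open>z\<close> along unit intervals, each interval costs one
  stage of the nest, since a stage contains all that touches the previous one.\<close>

lemma nest_ball:
  assumes n: "nest r p (0, 0) A B"
  shows "n < r \<Longrightarrow> l1 z \<le> int n \<Longrightarrow> oseg p f \<Longrightarrow> z \<in> {fst f, iend f} \<Longrightarrow> f \<in> set (A (Suc n)) \<union>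
    set (B (Suc n))"
proof (induction n arbitrary: z f)
  case 0
  then have "\<bar>fst z\<bar> + \<bar>snd z\<bar> \<le> 0" by (simp add: l1_def)
  then have "fst z = 0 \<and> snd z = 0" by linarith
  then have z: "z = (0, 0)" by (simp add: prod_eq_iff)
  have "separate p (0, 0) (A 0) (B 0)" using n by (simp add: nest_def)
  then obtain e where "e \<in> set (A 0)" "iend e = (0, 0)" by (auto simp: separate_def)
  then have "touch e f" using 0(4) z by (auto simp: touch_def)
  then show ?case using nest_touch[OF n 0(1), of e f] \<open>e \<in> set (A 0)\<close> 0(3) by simp
next
  case (Suc n)
  have step: "f \<in> set (A (Suc (Suc n))) \<union> set (B (Suc (Suc n)))"
    if "e \<in> set (A (Suc n)) \<union> set (B (Suc n))" "touch e f" for e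
    using nest_touch[OF n, of "Suc n" e f] Suc.prems that by blast
  show ?case
  proof (cases "l1 z \<le> int n")
    case True
    then have "f \<in> set (A (Suc n)) \<union> set (B (Suc n))" using Suc by simp
    then show ?thesis using step[of f] by (simp add: touch_def)
  next
    case False
    obtain a b where z: "z = (a, b)" by fastforce
    have "z \<noteq> (0, 0)" using False by (auto simp: l1_def)
    then consider "0 < a" | "a < 0" | "0 < b" | "b < 0" using z by force
    then have "\<exists>d\<in>set units. l1 (padd z d) \<le> int n"
      using Suc.prems(2) by cases (simp_all add: z units_def l1_def)
  then obtain d where d: "d \<in> set units" "l1 (padd z d) \<le> int n" by blast
  \<comment> \<open>The interval between \<open>z\<close> and \<open>padd z d\<close>, in the
    orientation that the convention prescribes.\<close>
  define g where "g = (if hor d = (even (fst z + snd z) = p) then (z, d) else (padd z d, pneg d))"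
  have g: "oseg p g" using d(1) odd_unit[OF d(1)] pneg_units[OF d(1)]
    unfolding g_def oseg_def
      by (auto simp only: fst_conv snd_conv even_padd hor_pneg split: if_splits)
  have ends: "{fst g, iend g} = {z, padd z d}" by (auto simp: g_def iend_def padd_assoc)
  have "g \<in> set (A (Suc n)) \<union> set (B (Suc n))" using Suc.IH[of "padd z d" g] Suc.prems d g ends
    by auto
  moreover have "touch g f" using ends Suc.prems(4) by (auto simp: touch_def)
  ultimately show ?thesis using step by blast
  qed
qed

text \<open>By induction, \<open>j\<close> steps from \<open>A 0\<close> end in \<open>A j\<close>:
  the successor of a segment touches it, hence lies in one of the two lists of the next stage, and
  changing sides is impossible.\<close>

lemma nest_apart:
  assumes n: "nest r p (0, 0) A B" "chain \<sigma> (A r)" "chain \<sigma> (B r)"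
    and e: "e1 \<in> set (A 0)" "e2 \<in> set (B 0)" and "m \<le> r"
  shows "(nxt \<sigma> ^^ m) e1 \<noteq> e2" "(nxt \<sigma> ^^ m) e2 \<noteq> e1"
proof -
  have sep: "separate p (0, 0) (A j) (B j)" if "j \<le> r" for j using n(1) that
    by (auto simp: nest_def)
  have ch: "chain \<sigma> (A j)" "chain \<sigma> (B j)" if "j \<le> r" for j
    using chain_sublist[OF n(2)] chain_sublist[OF n(3)] nest_mono[OF n(1) that] by auto
  have sub: "set (A j) \<subseteq> set (A (Suc j))" "set (B j) \<subseteq> set (B (Suc j))" if "j < r" for j
    using nest_mono[OF n(1), of j "Suc j"] that set_mono_sublist by auto
  have sub0: "set (A 0) \<subseteq> set (A m)" "set (B 0) \<subseteq> set (B m)"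
    using nest_mono[OF n(1), of 0 m] \<open>m \<le> r\<close> set_mono_sublist by auto
  \<comment> \<open>A change from \<open>X\<close> to \<open>Y\<close> could enter \<open>Y\<close>
    at its head, which the condition on the ends forbids, or at a later segment, whose only
    predecessor belongs to \<open>Y\<close>.\<close>
  have stay: "nxt \<sigma> f \<in> set X"
    if st: "f \<in> set X" "nxt \<sigma> f \<in> set X \<union> set Y" "chain \<sigma> X" "chain \<sigma> Y" "set X \<inter> set Y = {}"
       "iend (last X) \<noteq> fst (hd Y)" for f X Y
  proof (rule ccontr)
    assume no: "nxt \<sigma> f \<notin> set X"
    obtain i where i: "i < length X" "f = X ! i" using st(1) by (metis in_set_conv_nth)
    have "\<not> Suc i < length X"
    proof
      assume "Suc i < length X"
      then have "X ! Suc i = nxt \<sigma> f" using st(3) i by (simp add: successively_conv_nth)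
      then show False using no \<open>Suc i < length X\<close> by (metis nth_mem)
    qed
    then have "i = length X - 1" using i(1) by simp
    then have f: "f = last X" using i by (metis last_conv_nth length_0_conv less_nat_zero_code)
    have "nxt \<sigma> f \<in> set Y" using st(2) no by blast
    then obtain j where j: "j < length Y" "nxt \<sigma> f = Y ! j" by (metis in_set_conv_nth)
    show False
    proof (cases j)
      case 0
      then have "nxt \<sigma> f = hd Y" using j by (metis hd_conv_nth list.size(3) less_nat_zero_code)
      then show False using st(6) f by (metis fst_conv nxt_def)
    next
      case (Suc k)
      then have "Y ! j = nxt \<sigma> (Y ! k)" using st(4) j by (simp add: successively_conv_nth)
      then have "f = Y ! k" using j inj_nxt by metis
      then have "f \<in> set Y" using Suc j by simp
      then show False using st(1,5) by blast
    qed
  qed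
  have all: "nxt \<sigma> f \<in> set (A (Suc j)) \<union> set (B (Suc j))" if "j < r"
    "f \<in> set (A j) \<union> set (B j)" for f j
  proof -
    have "oseg p f" using sep[of j] that unfolding separate_def by auto
    then have "oseg p (nxt \<sigma> f)" by (rule oseg_nxt)
    moreover have "touch f (nxt \<sigma> f)" by (simp add: touch_def nxt_def)
    ultimately show ?thesis using nest_touch[OF n(1)] that by blast
  qed
  have "j \<le> r \<Longrightarrow> (nxt \<sigma> ^^ j) e1 \<in> set (A j)" for j
  proof (induction j)
    case (Suc j)
    let ?f = "(nxt \<sigma> ^^ j) e1"
    have "?f \<in> set (A j)" using Suc by simp
    then have "nxt \<sigma> ?f \<in> set (A (Suc j))"
      using stay[of ?f "A (Suc j)"
        "B (Suc j)"] all[of j ?f] ch[of "Suc j"] sep[of "Suc j"] sub[of j] Suc.prems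
      unfolding separate_def by auto
    then show ?case by simp
  qed (simp add: e)
  from this[OF \<open>m \<le> r\<close>] show "(nxt \<sigma> ^^ m) e1 \<noteq> e2" using sep[OF \<open>m \<le> r\<close>] sub0 e
    unfolding separate_def by auto
  have "j \<le> r \<Longrightarrow> (nxt \<sigma> ^^ j) e2 \<in> set (B j)" for j
  proof (induction j)
    case (Suc j)
    let ?f = "(nxt \<sigma> ^^ j) e2"
    have "?f \<in> set (B j)" using Suc by simp
    then have "nxt \<sigma> ?f \<in> set (B (Suc j))"
      using stay[of ?f "B (Suc j)"
        "A (Suc j)"] all[of j ?f] ch[of "Suc j"] sep[of "Suc j"] sub[of j] Suc.prems
      unfolding separate_def by auto
    then show ?case by simp
  qed (simp add: e)
  from this[OF \<open>m \<le> r\<close>] show "(nxt \<sigma> ^^ m) e2 \<noteq> e1" using sep[OF \<open>m \<le> r\<close>] sub0 e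
    unfolding separate_def by auto
qed

lemma incoming:
  assumes "oseg p e" "iend e = (0, 0)"
  shows "e = ((if p then (0, 1) else (1, 0)), pneg (if p then (0, 1) else (1, 0))) \<or>
         e = (pneg (if p then (0, 1) else (1, 0)), (if p then (0, 1) else (1, 0)))"
proof -
  obtain z d where e: "e = (z, d)" by (metis surj_pair)
  have d: "d \<in> set units" using assms by (simp add: oseg_def e)
  have z: "z = pneg d" using assms(2) by (cases z; cases d) (simp add: e iend_def)
  have "hor d \<noteq> p" using assms(1) odd_unit[OF pneg_units[OF d]] by (simp add: oseg_def e z)
  then show ?thesis using d by (cases p) (auto simp: e z units_def hor_def)
qed

text \<open>The nests for different \<open>r\<close> need not extend each other, but the innermost
  pair of each contains the two segments that arrive at the origin. These serve as \<open>e1\<close>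
  and \<open>e2\<close> for all \<open>r\<close>.\<close>

lemma two_orbits:
  assumes "\<And>r. two_ended r p \<sigma>"
  shows "\<exists>e1 e2. oseg p e1 \<and> oseg p e2 \<and> (\<forall>e. oseg p e \<longrightarrow> (\<exists>k. e = orbit \<sigma> e1 k) \<or>
    (\<exists>k. e = orbit \<sigma> e2 k)) \<and>
     (\<forall>k. orbit \<sigma> e1 k \<noteq> e2)"
proof -
  \<comment> \<open>The origin is even, so horizontal segments leave it if \<open>p\<close> holds,
    and then the arriving ones are vertical.\<close>
  define d :: pt where "d = (if p then (0, 1) else (1, 0))"
  define e1 where "e1 = (d, pneg d)"
  define e2 where "e2 = (pneg d, d)"
  have ex: "\<exists>A B a b. nest r p (0, 0) A B \<and> chain \<sigma> (A r) \<and> chain \<sigma> (B r) \<and> a \<in> set (A 0) \<and>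
    b \<in> set (B 0) \<and> {a, b} = {e1, e2} \<and> oseg p a \<and> oseg p b" for r
  proof -
    obtain A B where n: "nest r p (0, 0) A B" "chain \<sigma> (A r)" "chain \<sigma> (B r)" using assms[of r]
      by (auto simp: two_ended_def)
    then have "separate p (0, 0) (A 0) (B 0)" by (simp add: nest_def)
    then obtain a b where ab: "a \<in> set (A 0)" "b \<in> set (B 0)" "iend a = (0, 0)" "iend b = (0, 0)"
      "a \<noteq> b" "oseg p a" "oseg p b"
      unfolding separate_def by blast
    then have "{a, b} = {e1, e2}" using incoming[of p a] incoming[of p b]
      unfolding e1_def e2_def d_def by blast
    then show ?thesis using n ab by blast
  qed
  have o: "oseg p e1" "oseg p e2" using ex[of 0] by (auto simp: doubleton_eq_iff)
  have cov: "(\<exists>k. e = orbit \<sigma> e1 k) \<or> (\<exists>k. e = orbit \<sigma> e2 k)" if "oseg p e" for e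
  proof -
    define n where "n = nat (l1 (fst e))"
    obtain A B a b where ab: "nest (Suc n) p (0, 0) A B" "chain \<sigma> (A (Suc n))" "chain \<sigma> (B (Suc n))"
      "a \<in> set (A 0)" "b \<in> set (B 0)" "{a, b} = {e1, e2}"
      using ex[of "Suc n"] by blast
    have "l1 (fst e) \<le> int n" by (simp add: n_def)
    then have e: "e \<in> set (A (Suc n)) \<union> set (B (Suc n))"
      using nest_ball[OF ab(1), of n "fst e" e] that by auto
    have "a \<in> set (A (Suc n))" "b \<in> set (B (Suc n))"
      using nest_mono[OF ab(1), of 0 "Suc n"] ab(4,5) set_mono_sublist by blast+
    then have "(\<exists>k. e = orbit \<sigma> a k) \<or> (\<exists>k. e = orbit \<sigma> b k)"
      using e chain_connected[OF ab(2)] chain_connected[OF ab(3)] by blast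
    then show ?thesis using ab(6) by (auto simp: doubleton_eq_iff)
  qed
  have apart: "(nxt \<sigma> ^^ m) e1 \<noteq> e2" "(nxt \<sigma> ^^ m) e2 \<noteq> e1" for m
  proof -
    obtain A B a b where ab: "nest m p (0, 0) A B" "chain \<sigma> (A m)" "chain \<sigma> (B m)" "a \<in> set (A 0)"
      "b \<in> set (B 0)" "{a, b} = {e1, e2}"
      using ex[of m] by blast
    show "(nxt \<sigma> ^^ m) e1 \<noteq> e2" "(nxt \<sigma> ^^ m) e2 \<noteq> e1"
      using nest_apart[OF ab(1-5), of m] ab(6) by (auto simp: doubleton_eq_iff)
  qed
  have "orbit \<sigma> e1 k \<noteq> e2" for k
  proof (cases "0 \<le> k")
    case True
    then show ?thesis using apart(1) by (simp add: orbit_def)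
  next
    case False
    then have "orbit \<sigma> e1 (k + int (nat (- k))) = e1" by simp
    then show ?thesis using apart(2) orbit_add_nat by metis
  qed
  then show ?thesis using o cov by blast
qed

text \<open>Compactness by a diagonal argument: \<open>G n\<close> is a decreasing sequence of
  infinite sets of indices, and on \<open>G n\<close> the values at the first \<open>n\<close>
  points are constant.\<close>

lemma ex_limit:
  fixes f :: "nat \<Rightarrow> 'b :: countable \<Rightarrow> bool"
  shows "\<exists>g. \<forall>F N. finite F \<longrightarrow> (\<exists>k\<ge>N. \<forall>z\<in>F. f k z = g z)"
proof -
  define G where "G = rec_nat (UNIV :: nat set) (\<lambda>n S. if infinite {k\<in>S. f k (from_nat n)} then {k\<in>S. f k (from_nat n)} else {k\<in>S. \<not> f k (from_nat n)})"
  have G0: "G 0 = UNIV"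
    and GS: "G (Suc n) = (if infinite {k\<in>G n. f k (from_nat n)} then {k\<in>G n. f k (from_nat n)} else {k\<in>G n. \<not> f k (from_nat n)})" for n
    by (simp_all add: G_def)
  have inf: "infinite (G n)" for n
  proof (induction n)
    case (Suc n)
    have "G n = {k\<in>G n. f k (from_nat n)} \<union> {k\<in>G n. \<not> f k (from_nat n)}" by blast
    then have "infinite {k\<in>G n. f k (from_nat n)} \<or> infinite {k\<in>G n. \<not> f k (from_nat n)}" using Suc
      by (metis finite_Un)
    then show ?case by (auto simp: GS)
  qed (simp add: G0)
  have mono: "G n \<subseteq> G m" if "m \<le> n" for m n
    using that by (induction n rule: dec_induct) (auto simp: GS split: if_splits)
  define g where "g = (\<lambda>z. infinite {k\<in>G (to_nat z). f k z})"
  have g: "f k z = g z" if "k \<in> G (Suc (to_nat z))" for k z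
    using that by (auto simp: GS g_def split: if_splits)
  have "\<exists>k\<ge>N. \<forall>z\<in>F. f k z = g z" if fin: "finite F" for F N
  proof -
    obtain n where n: "\<forall>z\<in>F. to_nat z < n" using fin finite_nat_set_iff_bounded[of "to_nat ` F"]
      by auto
    obtain k where "k \<ge> N" "k \<in> G n" using infinite_nat_iff_unbounded_le[THEN iffD1, OF inf[of n]]
      by blast
    then have "\<forall>z\<in>F. f k z = g z" using g n mono[OF Suc_leI] by blast
    then show ?thesis using \<open>k \<ge> N\<close> by blast
  qed
  then show ?thesis by blast
qed

section \<open>Coverings and sign assignments\<close>

definition cpx :: "pt \<Rightarrow> complex" where "cpx z = Complex (of_int (fst z)) (of_int (snd z))"
definition emb :: "iseg \<Rightarrow> seg" where "emb e = (cpx (fst e), cpx (snd e))"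

lemma cpx_eq_iff [simp]: "cpx a = cpx b \<longleftrightarrow> a = b" by (auto simp: cpx_def prod_eq_iff)
lemma cpx_padd: "cpx (padd a b) = cpx a + cpx b"
  by (cases a; cases b) (simp add: cpx_def complex_eq_iff)
lemma cpx_pneg: "cpx (pneg a) = - cpx a" by (cases a) (simp add: cpx_def complex_eq_iff)
lemma cpx_mulI: "cpx (mulI a) = \<i> * cpx a" by (cases a) (simp add: cpx_def complex_eq_iff)
lemma cpx_simps: "cpx (1, 0) = 1" "cpx (0, 1) = \<i>" "cpx (-1, 0) = -1" "cpx (0, -1) = -\<i>"
  "cpx (0, 0) = 0"
  by (simp_all add: cpx_def complex_eq_iff)
lemma emb_eq_iff [simp]: "emb e = emb f \<longleftrightarrow> e = f" by (auto simp: emb_def prod_eq_iff)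
lemma seg_end_emb: "seg_end (emb e) = cpx (iend e)"
  by (simp add: seg_end_def emb_def iend_def cpx_padd)

lemma fst_emb: "fst (emb e) = cpx (fst e)" by (simp add: emb_def)

lemma gauss_int_iff: "z \<in> gauss_int \<longleftrightarrow> (\<exists>v. z = cpx v)"
proof
  assume "z \<in> gauss_int"
  then obtain a b where "Re z = of_int a" "Im z = of_int b" by (auto simp: gauss_int_def Ints_def)
  then have "z = cpx (a, b)" by (simp add: cpx_def complex_eq_iff)
  then show "\<exists>v. z = cpx v" by blast
qed (auto simp: gauss_int_def cpx_def)

lemma units_cpx: "x \<in> {1, -1, \<i>, -\<i>} \<longleftrightarrow> (\<exists>d\<in>set units. x = cpx d)"
  by (auto simp: units_def cpx_simps)

lemma unit_seg_iff: "unit_seg s \<longleftrightarrow> (\<exists>e. s = emb e \<and> snd e \<in> set units)"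
proof
  assume "unit_seg s"
  then obtain v d where "fst s = cpx v" "d \<in> set units" "snd s = cpx d"
    unfolding unit_seg_def units_cpx gauss_int_iff by blast
  then have "s = emb (v, d)" "snd (v, d) \<in> set units" by (simp_all add: emb_def prod_eq_iff)
  then show "\<exists>e. s = emb e \<and> snd e \<in> set units" by blast
qed (use units_cpx gauss_int_iff in \<open>auto simp: unit_seg_def emb_def\<close>)

lemma sgn_of_powi: "\<i> powi (sgn_of t) * cpx d = cpx (quarter t d)"
  by (cases t) (simp_all add: sgn_of_def quarter_def cpx_mulI cpx_pneg power_int_minus)

lemma turn_emb: "turn (sgn_of t) (emb e) s \<longleftrightarrow> s = emb (iend e, quarter t (snd e))"
  unfolding turn_def seg_end_emb
  by (auto simp: emb_def sgn_of_powi prod_eq_iff)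

lemma sgn_of_range: "a \<in> {1, -1} \<longleftrightarrow> (\<exists>t. a = sgn_of t)"
  by (auto simp: sgn_of_def)

definition even_pt :: "pt \<Rightarrow> bool" where "even_pt v \<longleftrightarrow> even (fst v + snd v)"

lemma even_pt_padd: "even_pt (padd v w) = (even_pt v = even_pt w)" unfolding even_pt_def
  by (rule even_padd)

lemma floor_cpx: "even (\<lfloor>Re (cpx v)\<rfloor> + \<lfloor>Im (cpx v)\<rfloor>) = even_pt v" by (simp add: cpx_def even_pt_def)

text \<open>This reduces a covering to \<open>p\<close> and \<open>\<sigma>\<close>: its curves
  follow the successor map, and each admissible segment occurs exactly once, which also rules out
  closed orbits.\<close>

definition represents :: "(int \<Rightarrow> seg) set \<Rightarrow> bool \<Rightarrow> (pt \<Rightarrow> bool) \<Rightarrow> bool" where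
  "represents C p \<sigma> \<longleftrightarrow> (\<forall>c\<in>C. \<forall>k. \<exists>e. oseg p e \<and> c k = emb e \<and> c (k + 1) = emb (nxt \<sigma> e)) \<and>
     (\<forall>e. oseg p e \<longrightarrow> (\<exists>!ck. fst ck \<in> C \<and> fst ck (snd ck) = emb e))"

lemma star:
  "{s. (\<exists>e. oseg p e \<and> s = emb e) \<and> (fst s = cpx v \<or> seg_end s = cpx v)} =
   (if even_pt v = p then {(cpx v, 1), (cpx v, -1), (cpx v + \<i>, -\<i>), (cpx v - \<i>, \<i>)}
    else {(cpx v + 1, -1), (cpx v - 1, 1), (cpx v, \<i>), (cpx v, -\<i>)})" (is "?L = ?R")
proof -
  have "?L = emb ` {e. oseg p e \<and> (fst e = v \<or> iend e = v)}"
  proof (intro set_eqI iffI)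
    fix s assume "s \<in> ?L"
    then obtain e where e: "oseg p e" "s = emb e" "fst s = cpx v \<or> seg_end s = cpx v" by blast
    then have "fst e = v \<or> iend e = v" by (simp add: seg_end_emb fst_emb)
    then show "s \<in> emb ` {e. oseg p e \<and> (fst e = v \<or> iend e = v)}" using e by blast
  next
    fix s assume "s \<in> emb ` {e. oseg p e \<and> (fst e = v \<or> iend e = v)}"
    then obtain e where e: "oseg p e" "s = emb e" "fst e = v \<or> iend e = v" by blast
    then have "fst s = cpx v \<or> seg_end s = cpx v" by (auto simp: seg_end_emb fst_emb)
    then show "s \<in> ?L" using e by blast
  qed
  also have "{e. oseg p e \<and> (fst e = v \<or> iend e = v)} =
     {(v, d) |d. d \<in> set units \<and> hor d = (even_pt v = p)} \<union> {(padd v (pneg d), d) |d. d \<in> set units \<and> hor d \<noteq> (even_pt v = p)}" (is "?A = ?B")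
  proof (intro set_eqI)
    fix e :: iseg
    obtain z d where e: "e = (z, d)" by (metis surj_pair)
    have "iend e = v \<longleftrightarrow> z = padd v (pneg d)"
      by (auto simp: e iend_def padd_assoc)
    moreover have "even_pt (padd v (pneg d)) = (\<not> even_pt v)" if "d \<in> set units"
      using odd_unit[OF pneg_units[OF that]] by (simp add: even_pt_padd) (simp add: even_pt_def)
    ultimately show "e \<in> ?A \<longleftrightarrow> e \<in> ?B"
      by (auto simp: e oseg_def even_pt_def)
  qed
  also have "emb ` ?B = ?R"
  proof (cases "even_pt v = p")
    case True
    then have "?B = {(v, (1, 0)), (v, (-1, 0)), (padd v (pneg (0, 1)), (0, 1)), (padd v (pneg (0, -1)), (0, -1))}"
      by (auto simp: units_def hor_def)
    then show ?thesis using True by (auto simp: emb_def cpx_padd cpx_simps)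
  next
    case False
    then have "?B = {(v, (0, 1)), (v, (0, -1)), (padd v (pneg (1, 0)), (1, 0)), (padd v (pneg (-1, 0)), (-1, 0))}"
      by (auto simp: units_def hor_def)
    then show ?thesis using False by (auto simp: emb_def cpx_padd cpx_simps)
  qed
  finally show ?thesis .
qed

section \<open>Supports of segments and coverings\<close>

lemma support_emb:
  assumes "oseg p e"
  shows "\<exists>z\<in>gauss_int. \<exists>x\<in>{1, \<i>}. seg_support (emb e) = closed_segment z (z + x)"
proof -
  obtain z d where e: "e = (z, d)" by (metis surj_pair)
  have "d \<in> set units" using assms by (simp add: oseg_def e)
  then consider "d = (1, 0)" | "d = (0, 1)" | "d = (-1, 0)" | "d = (0, -1)"
    by (auto simp: units_def)
  then show ?thesis
  proof cases
    case 1
    then show ?thesis by (auto simp: e seg_support_def seg_end_def emb_def cpx_simps gauss_int_iff)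
  next
    case 2
    then show ?thesis by (auto simp: e seg_support_def seg_end_def emb_def cpx_simps gauss_int_iff)
  next
    case 3
    have "seg_support (emb e) = closed_segment (cpx (padd z (-1, 0))) (cpx (padd z (-1, 0)) + 1)"
      by (simp add: 3 e seg_support_def seg_end_def emb_def cpx_padd cpx_simps closed_segment_commute)
    then show ?thesis using gauss_int_iff by blast
  next
    case 4
    have "seg_support (emb e) = closed_segment (cpx (padd z (0, -1))) (cpx (padd z (0, -1)) + \<i>)"
      by (simp add: 4 e seg_support_def seg_end_def emb_def cpx_padd cpx_simps closed_segment_commute)
    then show ?thesis using gauss_int_iff by blast
  qed
qed

lemma support_inj:
  assumes "oseg p e" "oseg p f" "seg_support (emb e) = seg_support (emb f)" shows "e = f"
proof -
  have "{cpx (fst e), cpx (iend e)} = {cpx (fst f), cpx (iend f)}"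
    using assms(3) closed_segment_eq unfolding seg_support_def seg_end_emb by (simp add: emb_def)
  then have *: "fst e = fst f \<and> iend e = iend f \<or> fst e = iend f \<and> iend e = fst f"
    by (simp add: doubleton_eq_iff)
  then have "mid e = mid f"
  proof -
    have "mid g = padd (fst g) (iend g)" for g by (simp add: mid_def iend_def padd_assoc)
    then show ?thesis using * padd_commute by metis
  qed
  then show ?thesis using mid_inj assms by blast
qed

lemma ex_support:
  assumes "z \<in> gauss_int" "x \<in> {1, \<i>}"
  shows "\<exists>e. oseg p e \<and> seg_support (emb e) = closed_segment z (z + x)"
proof -
  obtain v where z: "z = cpx v" using assms(1) gauss_int_iff by blast
  obtain d where d: "d \<in> set units" "x = cpx d" using assms(2) units_cpx by blast
  show ?thesis
  proof (cases "hor d = (even_pt v = p)")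
    case True
    then have "oseg p (v, d)" using d by (simp add: oseg_def even_pt_def)
    moreover have "seg_support (emb (v, d)) = closed_segment z (z + x)"
      by (simp add: seg_support_def seg_end_def emb_def z d)
    ultimately show ?thesis by blast
  next
    case False
    have "even_pt (padd v d) = (\<not> even_pt v)" using odd_unit[OF d(1)]
      by (simp add: even_pt_padd) (simp add: even_pt_def)
    then have "oseg p (padd v d, pneg d)" using d False pneg_units
      unfolding oseg_def even_pt_def[symmetric] fst_conv snd_conv hor_pneg by blast
    moreover have "seg_support (emb (padd v d, pneg d)) = closed_segment z (z + x)"
      by (simp add: seg_support_def seg_end_def emb_def z d cpx_padd cpx_pneg closed_segment_commute)
    ultimately show ?thesis by blast
  qed
qed

lemma represents_covering:
  assumes "represents C p \<sigma>" shows "covering C"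
  unfolding covering_def
proof (intro conjI ballI)
  have 1: "\<exists>e. oseg p e \<and> c k = emb e \<and> c (k + 1) = emb (nxt \<sigma> e)" if "c \<in> C" for c k
    using assms that by (auto simp: represents_def)
  have 2: "\<exists>!ck. fst ck \<in> C \<and> fst ck (snd ck) = emb e" if "oseg p e" for e using assms that
    by (auto simp: represents_def)
  show "complete_curve c" if c: "c \<in> C" for c
  proof -
    obtain E where E: "oseg p (E k)" "c k = emb (E k)" "c (k + 1) = emb (nxt \<sigma> (E k))" for k
      using 1[OF c] by metis
    have "complete_curve_of (\<lambda>k. sgn_of (\<sigma> (iend (E k)))) c"
      unfolding complete_curve_of_def
    proof (intro conjI allI)
      show "range (\<lambda>k. sgn_of (\<sigma> (iend (E k)))) \<subseteq> {1, - 1}" by (auto simp: sgn_of_def)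
      show "unit_seg (c k)" for k using E unit_seg_iff by (auto simp: oseg_def)
      show "turn (sgn_of (\<sigma> (iend (E k)))) (c k) (c (k + 1))" for k using E turn_emb
        by (simp add: nxt_def)
    qed
    then show ?thesis unfolding complete_curve_def by blast
  qed
  show "\<exists>!ck. fst ck \<in> C \<and> seg_support (fst ck (snd ck)) = closed_segment z (z + x)"
    if zx: "z \<in> gauss_int" "x \<in> {1, \<i>}" for z x
  proof -
    obtain e where e: "oseg p e" "seg_support (emb e) = closed_segment z (z + x)"
      using ex_support[OF zx] by blast
    have "fst ck \<in> C \<and> seg_support (fst ck (snd ck)) = closed_segment z (z + x) \<longleftrightarrow> fst ck \<in> C \<and>
      fst ck (snd ck) = emb e" for ck
      using 1[of "fst ck" "snd ck"] e support_inj[of p _ e] by metis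
    then show ?thesis using 2[OF e(1)] by simp
  qed
  have "segs C = {s. \<exists>e. oseg p e \<and> s = emb e}"
  proof (intro set_eqI iffI)
    fix s assume "s \<in> segs C"
    then obtain c k where "c \<in> C" "s = c k" by (auto simp: segs_def)
    then show "s \<in> {s. \<exists>e. oseg p e \<and> s = emb e}" using 1 by blast
  next
    fix s assume "s \<in> {s. \<exists>e. oseg p e \<and> s = emb e}"
    then obtain e where e: "oseg p e" "s = emb e" by blast
    then obtain ck where "fst ck \<in> C" "fst ck (snd ck) = emb e" using 2 by blast
    then show "s \<in> segs C" unfolding segs_def e(2) by (metis UN_I rangeI)
  qed
  then have eq: "{s \<in> segs C. fst s = cpx v \<or> seg_end s = cpx v} =
    {s. (\<exists>e. oseg p e \<and> s = emb e) \<and> (fst s = cpx v \<or> seg_end s = cpx v)}" for v by simp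
  show "oriented C"
    unfolding oriented_def
  proof (intro exI ballI)
    fix z assume "z \<in> gauss_int"
    then obtain v where v: "z = cpx v" using gauss_int_iff by blast
    show "{s \<in> segs C. fst s = z \<or> seg_end s = z} =
       (if even (\<lfloor>Re z\<rfloor> + \<lfloor>Im z\<rfloor>) = p
        then {(z, 1), (z, -1), (z + \<i>, -\<i>), (z - \<i>, \<i>)}
        else {(z + 1, -1), (z - 1, 1), (z, \<i>), (z, -\<i>)})"
      unfolding v eq star floor_cpx ..
  qed
qed

lemma fst_iend: "fst e = padd (iend e) (pneg (snd e))"
  by (simp add: iend_def padd_assoc)

lemma hor_iend: "oseg p e \<Longrightarrow> hor (snd e) = (even_pt (iend e) \<noteq> p)"
  using odd_unit[of "snd e"] unfolding oseg_def iend_def even_pt_def even_padd by blast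

lemma same_end:
  assumes "oseg p e" "oseg p f" "iend e = iend f" shows "e = f \<or> snd f = pneg (snd e)"
proof -
  have "hor (snd e) = hor (snd f)" using hor_iend assms by metis
  then have "snd f = snd e \<or> snd f = pneg (snd e)" using assms(1,2)
    by (auto simp: oseg_def units_def hor_def)
  then show ?thesis using fst_iend[of e] fst_iend[of f] assms(3) by (metis prod_eqI)
qed

lemma quarter_True_False: "d \<in> set units \<Longrightarrow> quarter True d \<noteq> quarter False d"
  by (auto simp: units_def quarter_def)

text \<open>The two curves through a lattice point arrive in opposite directions. If they turned
  differently, they would leave along the same segment, which would then occur twice in the
  covering.\<close>

lemma covering_represents:
  assumes "covering C" shows "\<exists>p \<sigma>. represents C p \<sigma>"
proof -
  obtain p where p: "\<And>z. z \<in> gauss_int \<Longrightarrow> {s \<in> segs C. fst s = z \<or> seg_end s = z} =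
       (if even (\<lfloor>Re z\<rfloor> + \<lfloor>Im z\<rfloor>) = p
        then {(z, 1), (z, -1), (z + \<i>, -\<i>), (z - \<i>, \<i>)}
        else {(z + 1, -1), (z - 1, 1), (z, \<i>), (z, -\<i>)})"
    using assms unfolding covering_def oriented_def by blast
  have star': "{s \<in> segs C. fst s = cpx v \<or> seg_end s = cpx v} =
    {s. (\<exists>e. oseg p e \<and> s = emb e) \<and> (fst s = cpx v \<or> seg_end s = cpx v)}" for v
    using p[of "cpx v"] gauss_int_iff unfolding star floor_cpx by blast
  have cc: "\<exists>a. range a \<subseteq> {1, - 1} \<and> (\<forall>k. unit_seg (c k)) \<and> (\<forall>k. turn (a k) (c k) (c (k + 1)))"
    if "c \<in> C" for c
    using assms that unfolding covering_def complete_curve_def complete_curve_of_def by blast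
  have segs: "s \<in> segs C \<longleftrightarrow> (\<exists>e. oseg p e \<and> s = emb e)" for s
  proof
    assume s: "s \<in> segs C"
    then obtain c k where "c \<in> C" "s = c k" by (auto simp: segs_def)
    then obtain f where "s = emb f" using cc unit_seg_iff by metis
    then have "s \<in> {s \<in> segs C. fst s = cpx (fst f) \<or> seg_end s = cpx (fst f)}" using s
      by (simp add: emb_def)
    then show "\<exists>e. oseg p e \<and> s = emb e" unfolding star' by blast
  next
    assume "\<exists>e. oseg p e \<and> s = emb e"
    then obtain e where e: "oseg p e" "s = emb e" by blast
    then have "s \<in> {s. (\<exists>e. oseg p e \<and> s = emb e) \<and> (fst s = cpx (fst e) \<or>
      seg_end s = cpx (fst e))}" by (auto simp: emb_def)
    then show "s \<in> segs C" unfolding star'[symmetric] by blast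
  qed
  have ex1: "\<exists>!ck. fst ck \<in> C \<and> fst ck (snd ck) = emb e" if e: "oseg p e" for e
  proof -
    obtain z x where zx: "z \<in> gauss_int" "x \<in> {1, \<i>}"
      "seg_support (emb e) = closed_segment z (z + x)"
      using support_emb[OF e] by blast
    have "fst ck \<in> C \<and> seg_support (fst ck (snd ck)) = closed_segment z (z + x) \<longleftrightarrow> fst ck \<in> C \<and>
      fst ck (snd ck) = emb e" for ck
    proof -
      have "\<exists>f. oseg p f \<and> fst ck (snd ck) = emb f" if "fst ck \<in> C"
        using segs[of "fst ck (snd ck)"] that by (auto simp: segs_def)
      then show ?thesis using support_inj[of p _ e] zx(3) e by metis
    qed
    moreover have "\<exists>!ck. fst ck \<in> C \<and> seg_support (fst ck (snd ck)) = closed_segment z (z + x)"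
      using assms zx(1,2) unfolding covering_def by blast
    ultimately show ?thesis by simp
  qed
  have step: "\<exists>e t. oseg p e \<and> c k = emb e \<and> c (k + 1) = emb (iend e, quarter t (snd e))"
    if c: "c \<in> C" for c k
  proof -
    obtain a where a: "range a \<subseteq> {1, - 1}" "turn (a k) (c k) (c (k + 1))" using cc[OF c] by blast
    have "c k \<in> segs C" using c unfolding segs_def by blast
    then obtain e where "oseg p e" "c k = emb e" using segs by blast
    moreover obtain t where "a k = sgn_of t" using a(1) sgn_of_range by blast
    ultimately show ?thesis using a(2) turn_emb by metis
  qed
  define \<sigma>
    where "\<sigma> w \<longleftrightarrow> (\<exists>c\<in>C. \<exists>k e. oseg p e \<and> iend e = w \<and> c k = emb e \<and>
    c (k + 1) = emb (iend e, quarter True (snd e)))" for w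
  have "c (k + 1) = emb (nxt \<sigma> e)" if c: "c \<in> C" "oseg p e" "c k = emb e" for c k e
  proof -
    obtain t where t: "c (k + 1) = emb (iend e, quarter t (snd e))" using step[OF c(1), of k] c(3)
      by auto
    have "\<sigma> (iend e) = t"
    proof (cases t)
      case True
      then have "c (k + 1) = emb (iend e, quarter True (snd e))" using t by simp
      then have "\<sigma> (iend e)" unfolding \<sigma>_def using c by blast
      then show ?thesis using True by simp
    next
      case False
      have "\<not> \<sigma> (iend e)"
      proof
        assume "\<sigma> (iend e)"
        then obtain c' k' e' where c': "c' \<in> C" "oseg p e'" "iend e' = iend e" "c' k' = emb e'"
          "c' (k' + 1) = emb (iend e', quarter True (snd e'))"
          unfolding \<sigma>_def by blast
        have ne: "(c', k') \<noteq> (c, k)"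
        proof
          assume "(c', k') = (c, k)"
          then have k: "c' = c" "k' = k" by simp_all
          then have "e' = e" using c'(4) c(3) by simp
          then have "quarter True (snd e) = quarter t (snd e)" using c'(5) t k by simp
          then show False using False c(2) quarter_True_False by (simp add: oseg_def)
        qed
        have "e \<noteq> e'"
        proof
          assume "e = e'"
          then have "fst (c', k') \<in> C \<and> fst (c', k') (snd (c', k')) = emb e"
            "fst (c, k) \<in> C \<and> fst (c, k) (snd (c, k)) = emb e"
            using c c' by simp_all
          then show False using ex1[OF c(2)] ne by blast
        qed
        have d': "snd e' = pneg (snd e)" using same_end[OF c(2) c'(2)] c'(3) \<open>e \<noteq> e'\<close> by simp
        have "quarter True (pneg x) = quarter False x" for x by (cases x) (simp add: quarter_def)
        then have "c' (k' + 1) = c (k + 1)" using c'(3,5) t False d' by simp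
        moreover have "oseg p (iend e, quarter t (snd e))" using oseg_nxt[OF c(2), of "\<lambda>_. t"]
          by (simp add: nxt_def)
        moreover have "fst (c', k' + 1) \<in> C \<and>
          fst (c', k' + 1) (snd (c', k' + 1)) = emb (iend e, quarter t (snd e))"
           "fst (c, k + 1) \<in> C \<and> fst (c, k + 1) (snd (c, k + 1)) = emb (iend e, quarter t (snd e))"
          using c(1) c'(1) t calculation(1) by simp_all
        ultimately have "(c', k' + 1) = (c, k + 1)" using ex1 by blast
        then show False using ne by simp
      qed
      then show ?thesis using False by simp
    qed
    then show ?thesis using t by (simp add: nxt_def)
  qed
  then have "\<exists>e. oseg p e \<and> c k = emb e \<and> c (k + 1) = emb (nxt \<sigma> e)" if "c \<in> C" for c k
    using step[OF that, of k] that by blast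
  then have "represents C p \<sigma>" unfolding represents_def using ex1 by simp
  then show ?thesis by blast
qed

section \<open>Finite parts of a represented covering\<close>

lemma represents_step: "represents C p \<sigma> \<Longrightarrow> c \<in> C \<Longrightarrow> \<exists>e. oseg p e \<and> c k = emb e \<and>
  c (k + 1) = emb (nxt \<sigma> e)"
  by (simp add: represents_def)

lemma represents_unique:
  "represents C p \<sigma> \<Longrightarrow> oseg p e \<Longrightarrow> c \<in> C \<Longrightarrow> c k = emb e \<Longrightarrow> c' \<in> C \<Longrightarrow> c' k' = emb e \<Longrightarrow> c = c' \<and> k = k'"
  unfolding represents_def by (metis fst_conv snd_conv)

lemma represents_ex: "represents C p \<sigma> \<Longrightarrow> oseg p e \<Longrightarrow> \<exists>c\<in>C. \<exists>k. c k = emb e"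
  unfolding represents_def by blast

lemma represents_funpow:
  assumes "represents C p \<sigma>" "c \<in> C" "c k = emb e"
  shows "c (k + int n) = emb ((nxt \<sigma> ^^ n) e)"
proof (induction n)
  case (Suc n)
  obtain f where "c (k + int n) = emb f" "c (k + int n + 1) = emb (nxt \<sigma> f)"
    using represents_step[OF assms(1,2)] by blast
  then show ?case using Suc by (simp add: algebra_simps)
qed (simp add: assms)

lemma represents_aperiodic:
  assumes "represents C p \<sigma>" "oseg p e" "0 < n"
  shows "(nxt \<sigma> ^^ n) e \<noteq> e"
proof
  assume eq: "(nxt \<sigma> ^^ n) e = e"
  obtain c k where c: "c \<in> C" "c k = emb e" using represents_ex[OF assms(1,2)] by blast
  then have "c (k + int n) = emb e" using represents_funpow[OF assms(1) c, of n] eq by simp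
  then show False using represents_unique[OF assms(1,2) c(1,2) c(1), of "k + int n"] assms(3)
    by simp
qed

lemma represents_blocks:
  assumes "represents C p \<sigma>"
  shows "(\<exists>c\<in>C. \<exists>i j. i \<le> j \<and> L = map c [i..j]) \<longleftrightarrow> (\<exists>l. l \<noteq> [] \<and> (\<forall>e\<in>set l. oseg p e) \<and> chain \<sigma> l \<and>
    L = map emb l)"
proof
  assume "\<exists>c\<in>C. \<exists>i j. i \<le> j \<and> L = map c [i..j]"
  then obtain c i j where c: "c \<in> C" "i \<le> j" "L = map c [i..j]" by blast
  have "\<forall>k. \<exists>e. oseg p e \<and> c k = emb e \<and> c (k + 1) = emb (nxt \<sigma> e)"
    using represents_step[OF assms c(1)] by blast
  then obtain E where E: "\<And>k. oseg p (E k)" "\<And>k. c k = emb (E k)"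
    "\<And>k. c (k + 1) = emb (nxt \<sigma> (E k))" by metis
  have "E (i + (1 + int n)) = nxt \<sigma> (E (i + int n))" for n
    using E(2)[of "i + int n + 1"] E(3)[of "i + int n"] by (simp add: algebra_simps)
  then have "chain \<sigma> (map E [i..j])"
    by (auto simp: successively_conv_nth nth_upto)
  moreover have "map E [i..j] \<noteq> []" using c(2) by simp
  moreover have "L = map emb (map E [i..j])" using c(3) E(2) by simp
  moreover have "\<forall>e\<in>set (map E [i..j]). oseg p e" using E(1) by simp
  ultimately show "\<exists>l. l \<noteq> [] \<and> (\<forall>e\<in>set l. oseg p e) \<and> chain \<sigma> l \<and> L = map emb l" by blast
next
  assume "\<exists>l. l \<noteq> [] \<and> (\<forall>e\<in>set l. oseg p e) \<and> chain \<sigma> l \<and> L = map emb l"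
  then obtain l where l: "l \<noteq> []" "\<forall>e\<in>set l. oseg p e" "chain \<sigma> l" "L = map emb l" by blast
  then obtain c k where c: "c \<in> C" "c k = emb (hd l)" using represents_ex[OF assms, of "hd l"]
    by auto
  let ?j = "k + int (length l) - 1"
  have "L = map c [k..?j]"
  proof (rule nth_equalityI)
    show "length L = length (map c [k..?j])" by (simp add: l(4))
    fix i assume "i < length L"
    then have i: "i < length l" by (simp add: l(4))
    then have "l ! i = (nxt \<sigma> ^^ i) (hd l)" using chain_nth[OF l(3), of 0 i] l(1)
      by (simp add: hd_conv_nth)
    then show "L ! i = map c [k..?j] ! i" using represents_funpow[OF assms c, of i] i
      by (simp add: l(4) nth_upto)
  qed
  moreover have "k \<le> ?j" using l(1) by (cases l) auto
  ultimately show "\<exists>c\<in>C. \<exists>i j. i \<le> j \<and> L = map c [i..j]" using c(1) by blast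
qed

text \<open>The counterpart of \<open>sub_curves\<close> for \<open>p\<close> and
  \<open>\<sigma>\<close>. It depends on the signs at the end points of segments in
  \<open>BL\<close> only, so it can be carried over between a covering, its translates and a
  limit.\<close>

definition sub_chains :: "iseg list set \<Rightarrow> bool \<Rightarrow> (pt \<Rightarrow> bool) \<Rightarrow> bool" where
  "sub_chains BL p \<sigma> \<longleftrightarrow> (\<forall>l\<in>BL. l \<noteq> [] \<and> (\<forall>e\<in>set l. oseg p e) \<and> chain \<sigma> l) \<and>
     (\<forall>l. l \<noteq> [] \<and> (\<forall>e\<in>set l. oseg p e) \<and> chain \<sigma> l \<and> set l \<subseteq> (\<Union>b\<in>BL. set b) \<longrightarrow> (\<exists>b\<in>BL. sublist l b))"

lemma inj_emb: "inj emb" by (simp add: inj_def)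

lemma sublist_map_emb: "sublist (map emb l) (map emb b) \<longleftrightarrow> sublist l b"
proof
  assume "sublist (map emb l) (map emb b)"
  then have "sublist (map (inv emb) (map emb l)) (map (inv emb) (map emb b))"
    by (rule map_mono_sublist)
  then show "sublist l b" by (simp add: inj_emb)
qed (rule map_mono_sublist)

lemma sub_curves_sub_chains:
  assumes "represents C p \<sigma>" "[] \<notin> BL"
  shows "sub_curves (map emb ` BL) C \<longleftrightarrow> sub_chains BL p \<sigma>"
proof -
  have block: "(\<exists>c\<in>C. \<exists>i j. map emb l = map c [i..j]) \<longleftrightarrow> (\<forall>e\<in>set l. oseg p e) \<and> chain \<sigma> l"
    if "l \<noteq> []" for l
  proof -
    have "(\<exists>c\<in>C. \<exists>i j. map emb l = map c [i..j]) \<longleftrightarrow> (\<exists>c\<in>C. \<exists>i j. i \<le> j \<and> map emb l = map c [i..j])"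
    proof
      assume "\<exists>c\<in>C. \<exists>i j. map emb l = map c [i..j]"
      then obtain c i j where c: "c \<in> C" "map emb l = map c [i..j]" by blast
      then have "[i..j] \<noteq> []" using that by auto
      then have "i \<le> j" by simp
      then show "\<exists>c\<in>C. \<exists>i j. i \<le> j \<and> map emb l = map c [i..j]" using c by blast
    qed blast
    also have "\<dots> \<longleftrightarrow> (\<forall>e\<in>set l. oseg p e) \<and> chain \<sigma> l"
      unfolding represents_blocks[OF assms(1)] using that inj_map_eq_map[OF inj_emb] by metis
    finally show ?thesis .
  qed
  have ne: "l \<noteq> []" if "l \<in> BL" for l using assms(2) that by blast
  have 1: "(\<forall>b\<in>map emb ` BL. \<exists>c\<in>C. \<exists>i j. b = map c [i..j]) \<longleftrightarrow> (\<forall>l\<in>BL. l \<noteq> [] \<and> (\<forall>e\<in>set l. oseg p e) \<and>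
    chain \<sigma> l)"
    using block[OF ne] ne by simp
  have un: "set (map emb l) \<subseteq> (\<Union>b\<in>map emb ` BL. set b) \<longleftrightarrow> set l \<subseteq> (\<Union>b\<in>BL. set b)" for l
  proof -
    have "(\<Union>b\<in>map emb ` BL. set b) = emb ` (\<Union>b\<in>BL. set b)" by auto
    then show ?thesis by (simp add: inj_image_subset_iff[OF inj_emb])
  qed
  have ex: "(\<exists>b\<in>map emb ` BL. sublist (map emb l) b) \<longleftrightarrow> (\<exists>b\<in>BL. sublist l b)" for l
    by (simp add: sublist_map_emb)
  have "(\<forall>c\<in>C. \<forall>i j. i \<le> j \<and> set (map c [i..j]) \<subseteq> (\<Union>b\<in>map emb ` BL. set b) \<longrightarrow>
        (\<exists>b\<in>map emb ` BL. sublist (map c [i..j]) b)) \<longleftrightarrow>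
     (\<forall>L. (\<exists>c\<in>C. \<exists>i j. i \<le> j \<and> L = map c [i..j]) \<longrightarrow> set L \<subseteq> (\<Union>b\<in>map emb ` BL. set b) \<longrightarrow> (\<exists>b\<in>map emb ` BL. sublist L b))"
    by blast
  also have "\<dots> \<longleftrightarrow> (\<forall>l. l \<noteq> [] \<and> (\<forall>e\<in>set l. oseg p e) \<and> chain \<sigma> l \<longrightarrow>
       set (map emb l) \<subseteq> (\<Union>b\<in>map emb ` BL. set b) \<longrightarrow> (\<exists>b\<in>map emb ` BL. sublist (map emb l) b))"
    unfolding represents_blocks[OF assms(1)] by blast
  also have "\<dots> \<longleftrightarrow> (\<forall>l. l \<noteq> [] \<and> (\<forall>e\<in>set l. oseg p e) \<and> chain \<sigma> l \<and> set l \<subseteq> (\<Union>b\<in>BL. set b) \<longrightarrow>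
    (\<exists>b\<in>BL. sublist l b))"
    unfolding un ex by blast
  finally show ?thesis unfolding sub_curves_def sub_chains_def 1 by simp
qed

lemma sub_curves_embedded:
  assumes "represents C p \<sigma>" "finite B" "[] \<notin> B" "sub_curves B C"
  shows "\<exists>BL. finite BL \<and> [] \<notin> BL \<and> B = map emb ` BL"
proof (intro exI conjI)
  let ?BL = "{l. map emb l \<in> B}"
  have "inj (map emb)" using inj_emb by (rule inj_mapI)
  then show "finite ?BL" using assms(2) finite_vimageI[of B "map emb"] by (simp add: vimage_def)
  show "[] \<notin> ?BL" using assms(3) by simp
  show "B = map emb ` ?BL"
  proof (intro set_eqI iffI)
    fix b assume b: "b \<in> B"
    then obtain c i j where c: "c \<in> C" "b = map c [i..j]" using assms(4) unfolding sub_curves_def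
      by blast
    have "b \<noteq> []" using b assms(3) by auto
    then have "i \<le> j" using c by auto
    then obtain l where "b = map emb l" using represents_blocks[OF assms(1), of b] c by blast
    then show "b \<in> map emb ` ?BL" using b by blast
  qed auto
qed

lemma shift_pneg [simp]: "shift v (shift (pneg v) e) = e" "shift (pneg v) (shift v e) = e"
  by (simp_all add: shift_def padd_assoc[symmetric])

text \<open>A translation by an odd vector exchanges the two orientation conventions, which is the
  source of the terms \<open>p = even_pt v\<close>.\<close>

lemma oseg_shift: "oseg p (shift v e) = oseg (p = even_pt v) e"
  using even_padd[of v "fst e"] by (auto simp: oseg_def shift_def even_pt_def)

lemma iend_shift: "iend (shift v e) = padd v (iend e)" by (simp add: iend_def shift_def padd_assoc)

lemma nxt_shift: "nxt \<sigma> (shift v e) = shift v (nxt (\<lambda>z. \<sigma> (padd v z)) e)"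
  by (simp add: nxt_def iend_shift) (simp add: shift_def)

lemma shift_eq_iff [simp]: "shift v e = shift v f \<longleftrightarrow> e = f" by (metis shift_pneg(2))

lemma chain_shift: "chain \<sigma> (map (shift v) L) = chain (\<lambda>z. \<sigma> (padd v z)) L"
  by (simp add: successively_map nxt_shift)

lemma nxt_pow_shift: "(nxt \<sigma> ^^ n) (shift v e) = shift v ((nxt (\<lambda>z. \<sigma> (padd v z)) ^^ n) e)"
  by (induction n) (simp_all add: nxt_shift)

lemma sub_chains_shift: "sub_chains (map (shift v) ` BL) p \<sigma> \<longleftrightarrow>
  sub_chains BL (p = even_pt v) (\<lambda>z. \<sigma> (padd v z))"
proof -
  let ?s = "map (shift v)"
  have surj: "(\<forall>l. P l) \<longleftrightarrow> (\<forall>l. P (?s l))" for P :: "iseg list \<Rightarrow> bool"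
  proof
    assume P: "\<forall>l. P (?s l)"
    show "\<forall>l. P l"
    proof
      fix l
      have "?s (map (shift (pneg v)) l) = l" by (simp add: comp_def)
      then show "P l" using P by metis
    qed
  qed blast
  have sub: "sublist (?s l) (?s b) \<longleftrightarrow> sublist l b" for l b
  proof
    assume "sublist (?s l) (?s b)"
    then have "sublist (map (shift (pneg v)) (?s l)) (map (shift (pneg v)) (?s b))"
      by (rule map_mono_sublist)
    then show "sublist l b" by (simp add: comp_def)
  qed (rule map_mono_sublist)
  have un: "set (?s l) \<subseteq> (\<Union>b\<in>?s ` BL. set b) \<longleftrightarrow> set l \<subseteq> (\<Union>b\<in>BL. set b)" for l
  proof -
    have "(\<Union>b\<in>?s ` BL. set b) = shift v ` (\<Union>b\<in>BL. set b)" by auto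
    moreover have "inj (shift v)" by (simp add: inj_def)
    ultimately show ?thesis by (simp add: inj_image_subset_iff)
  qed
  have ne: "?s l \<noteq> [] \<longleftrightarrow> l \<noteq> []" for l by simp
  have os: "(\<forall>e\<in>set (?s l). oseg p e) \<longleftrightarrow> (\<forall>e\<in>set l. oseg (p = even_pt v) e)" for l
    by (simp add: oseg_shift)
  show ?thesis
    unfolding sub_chains_def
    by (subst surj) (simp only: ball_simps bex_simps un ne os chain_shift sub)
qed

lemma sub_chains_cong:
  assumes "\<And>l e. l \<in> BL \<Longrightarrow> e \<in> set l \<Longrightarrow> \<sigma> (iend e) = \<sigma>' (iend e)"
  shows "sub_chains BL p \<sigma> = sub_chains BL p \<sigma>'"
proof -
  have ch: "chain \<sigma> l = chain \<sigma>' l" if l: "set l \<subseteq> (\<Union>b\<in>BL. set b)" for l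
  proof -
    have "nxt \<sigma> e = nxt \<sigma>' e" if e: "e \<in> set l" for e
    proof -
      obtain b where "b \<in> BL" "e \<in> set b" using l e by blast
      then show ?thesis using assms by (simp add: nxt_def)
    qed
    then show ?thesis by (intro successively_cong) auto
  qed
  have "chain \<sigma> l = chain \<sigma>' l" if "l \<in> BL" for l using ch[of l] that by blast
  then show ?thesis unfolding sub_chains_def using ch
    by (intro conj_cong ball_cong all_cong refl) blast+
qed

lemma translate_emb: "translate (cpx v) (map emb ` BL) = map emb ` (map (shift v) ` BL)"
proof -
  have "(\<lambda>s. (fst s + cpx v, snd s)) (emb e) = emb (shift v e)" for e
    by (simp add: emb_def shift_def cpx_padd)
  then show ?thesis unfolding translate_def by (auto simp: image_image comp_def)
qed

lemma even_pt_pneg [simp]: "even_pt (pneg v) = even_pt v" by (cases v) (auto simp: even_pt_def)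

section \<open>Coverings by two curves\<close>

lemma padd_pneg_cancel: "padd w (padd (pneg w) z) = z"
  by (simp add: padd_assoc[symmetric])

lemma touch_shift: "touch (shift v e) (shift v f) = touch e f"
  by (simp add: touch_def iend_shift) (simp add: shift_def padd_cancel)

lemma separate_shift:
  assumes "separate p w A B"
  shows "separate (p = even_pt w) (0, 0) (map (shift (pneg w)) A) (map (shift (pneg w)) B)"
proof -
  let ?s = "shift (pneg w)"
  have ne: "A \<noteq> []" "B \<noteq> []" using assms by (auto simp: separate_def)
  have o: "oseg (p = even_pt w) (?s e) = oseg p e" for e
  proof -
    have "((p = even_pt w) = even_pt w) = p" by blast
    then show ?thesis by (simp add: oseg_shift)
  qed
  have "?s ` set A \<inter> ?s ` set B = {}" using assms by (auto simp: separate_def)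
  moreover have "\<exists>e\<in>?s ` X. iend e = (0, 0)" if w: "\<exists>e\<in>X. iend e = w" for X
  proof -
    obtain e where "e \<in> X" "iend e = w" using w by blast
    then have "?s e \<in> ?s ` X" "iend (?s e) = (0, 0)" by (simp_all add: iend_shift)
    then show ?thesis by blast
  qed
  moreover have "fst (?s e) = padd (pneg w) (fst e)" for e by (simp add: shift_def)
  ultimately show ?thesis using assms ne
    by (simp add: separate_def o iend_shift last_map hd_map padd_cancel ball_Un)
qed

lemma nest_shift:
  assumes "nest k p w A B"
  shows "nest k (p = even_pt w) (0, 0) (\<lambda>j. map (shift (pneg w)) (A j)) (\<lambda>j. map (shift (pneg w)) (B j))"
proof -
  let ?s = "shift (pneg w)"
  have int: "f \<in> set (map ?s (A (Suc j))) \<union> set (map ?s (B (Suc j)))"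
    if j: "j < k" and e: "e \<in> set (map ?s (A j)) \<union> set (map ?s (B j))"
      and f: "oseg (p = even_pt w) f" "touch e f" for j e f
  proof -
    obtain e' where e': "e' \<in> set (A j) \<union> set (B j)" "e = ?s e'" using e by auto
    have "touch e' (shift w f)" using f(2) touch_shift[of w e f] e'(2) by simp
    moreover have "oseg p (shift w f)" using f(1) by (simp add: oseg_shift)
    ultimately have "shift w f \<in> set (A (Suc j)) \<union> set (B (Suc j))"
      using nest_touch[OF assms j e'(1)] by blast
    then have "?s (shift w f) \<in> ?s ` (set (A (Suc j)) \<union> set (B (Suc j)))" by (rule imageI)
    then show ?thesis by (simp add: image_Un)
  qed
  have "separate (p = even_pt w) (0, 0) (map ?s (A j)) (map ?s (B j))" if "j \<le> k" for j
    using separate_shift assms that by (simp add: nest_def)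
  then show ?thesis using assms int unfolding nest_def by (auto simp: map_mono_sublist)
qed

lemma two_ended_mono:
  assumes "two_ended k p \<sigma>" "r \<le> k" shows "two_ended r p \<sigma>"
proof -
  obtain A B where n: "nest k p (0, 0) A B" "chain \<sigma> (A k)" "chain \<sigma> (B k)" using assms(1)
    by (auto simp: two_ended_def)
  have "nest r p (0, 0) A B" using n(1) assms(2) unfolding nest_def by auto
  moreover have "chain \<sigma> (A r)" "chain \<sigma> (B r)"
    using nest_mono[OF n(1) assms(2)] n(2,3) chain_sublist by blast+
  ultimately show ?thesis by (auto simp: two_ended_def)
qed

section \<open>Inflated segments in folding curves\<close>

lemma walk_shift: "walk (shift v e) S = map (shift v) (walk e S)"
proof (induction S arbitrary: e)
  case (Cons t S)
  have "(iend (shift v e), quarter t (snd (shift v e))) = shift v (iend e, quarter t (snd e))"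
    by (simp add: iend_shift) (simp add: shift_def)
  then show ?case using Cons by simp
qed simp

lemma curve_walk:
  assumes "complete_curve_of a c" "c K = emb e" "\<And>i. i < length S \<Longrightarrow> a (K + int i) = sgn_of (S ! i)"
  shows "map c [K..K + int (length S)] = map emb (walk e S)"
  using assms(2,3)
proof (induction S arbitrary: K e)
  case Nil
  then show ?case by simp
next
  case (Cons t S)
  have "a K = sgn_of t" using Cons.prems(2)[of 0] by simp
  moreover have "turn (a K) (c K) (c (K + 1))" using assms(1) by (simp add: complete_curve_of_def)
  ultimately have "c (K + 1) = emb (iend e, quarter t (snd e))" using turn_emb Cons.prems(1) by simp
  moreover have "a (K + 1 + int i) = sgn_of (S ! i)" if "i < length S" for i
    using Cons.prems(2)[of "Suc i"] that by (simp add: algebra_simps)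
  ultimately have "map c [K + 1..K + 1 + int (length S)] = map emb (walk (iend e, quarter t (snd e)) S)"
    using Cons.IH by blast
  moreover have "[K..K + int (length (t # S))] = K # [K + 1..K + 1 + int (length S)]"
    by (subst upto_rec1) (simp_all add: algebra_simps)
  ultimately show ?case using Cons.prems(1) by simp
qed

lemma mulI_pneg: "mulI (pneg d) = pneg (mulI d)"
  by (cases d) simp

text \<open>A half-turn keeps horizontal segments horizontal and therefore commutes with
  inflation.\<close>

lemma hd_inflate_pneg: "snd (hd (inflate ws [(z, pneg d)])) = pneg (snd (hd (inflate ws [(z', d)])))"
proof (induction ws arbitrary: z z' d)
  case (Cons s ws)
  let ?d = "\<lambda>d. if s = hor d then d else mulI d"
  have hd_eq: "hd (inflate (s # ws) [(z, d)]) = hd (inflate ws [(mulT z, ?d d)])" for z d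
  proof -
    have "\<exists>e. inflate1 s (z, d) = [(mulT z, ?d d), e]" by (cases "s = hor d") simp_all
    then obtain e where "inflate1 s (z, d) = [(mulT z, ?d d), e]" by blast
    then have "inflate (s # ws) [(z, d)] = inflate ws [(mulT z, ?d d)] @ inflate ws [e]"
      using inflate_append[of ws "[(mulT z, ?d d)]" "[e]"] by (simp del: inflate1.simps)
    then show ?thesis by (simp add: inflate_neq_Nil)
  qed
  have "?d (pneg d) = pneg (?d d)" by (simp add: mulI_pneg)
  then show ?case unfolding hd_eq by (simp only: Cons.IH[of _ "?d d" "mulT z'"])
qed simp

text \<open>The last sign makes the first fine segment parallel to \<open>x\<close>, and passing
  from \<open>d\<close> to \<open>pneg d\<close> reverses it.\<close>

lemma ex_direction:
  assumes "x \<in> set units" "ws \<noteq> []" "hor x = last ws"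
  shows "\<exists>d\<in>set units. hor d = h \<and> hd (inflate ws [((0, 0), d)]) = ((0, 0), x)"
proof -
  have "\<exists>d\<in>set units. hor d = h" by (cases h) (auto simp: units_def hor_def)
  then obtain d0 where d0: "d0 \<in> set units" "hor d0 = h" by blast
  let ?e = "\<lambda>d. hd (inflate ws [((0, 0), d)])"
  have f: "fst (?e d) = (0, 0)" for d using inflate_ends[of ws "((0,0), d)"] by simp
  have "?e d0 \<in> set (inflate ws [((0, 0), d0)])" by (simp add: inflate_neq_Nil)
  moreover have "oseg h ((0, 0), d0)" using d0 by (simp add: oseg_def)
  ultimately have "oseg (last (h # ws)) (?e d0)"
    using oseg_inflate[of "[((0, 0), d0)]" h "?e d0" ws] by simp
  then have u: "snd (?e d0) \<in> set units" "hor (snd (?e d0)) = hor x" using assms(2,3) f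
    by (simp_all add: oseg_def)
  then have "snd (?e d0) = x \<or> snd (?e d0) = pneg x" using assms(1)
    by (auto simp: units_def hor_def)
  then have "?e d0 = ((0, 0), x) \<or> ?e (pneg d0) = ((0, 0), x)"
    using f hd_inflate_pneg[of ws "(0, 0)" d0 "(0, 0)"] by (metis pneg_pneg prod.collapse)
  moreover have "pneg d0 \<in> set units" "hor (pneg d0) = h" using d0 pneg_units by simp_all
  ultimately show ?thesis using d0 by blast
qed

text \<open>The turns of the curve contain an \<open>n\<close>-folding sequence, hence the turns of
  an inflated segment. Once the last sign and the direction \<open>d\<close> are fitted to the first
  segment of that block, the block and the inflated segment agree up to translation.\<close>

lemma folding_curve_block:
  assumes "represents C p \<sigma>" "c \<in> C" "complete_folding_curve c" "0 < n"
  shows "\<exists>v ws d. length ws = n \<and> d \<in> set units \<and>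
    (\<forall>e\<in>set (inflate ws [((0, 0), d)]). oseg (p = even_pt v) e) \<and>
    chain (\<lambda>z. \<sigma> (padd v z)) (inflate ws [((0, 0), d)])"
proof -
  obtain a where a: "complete_folding_seq a" "complete_curve_of a c" using assms(3)
    by (auto simp: complete_folding_curve_def)
  \<comment> \<open>These are \<open>2 ^ Suc n + 1\<close> terms, enough for
    \<open>folding_block\<close>.\<close>
  define W where "W = map a [0..int (2 ^ Suc n)]"
  obtain N T where N: "folding_seq N T" "sublist W T" using a(1)
    unfolding complete_folding_seq_def W_def by blast
  have "length W = 2 ^ Suc n + 1" unfolding W_def length_map length_upto by linarith
  then have "2 ^ Suc n - 1 \<le> length W" by linarith
  then obtain X where X: "folding_seq n X" "sublist X W" using folding_block[OF N] by blast
  obtain P Q where PQ: "W = P @ X @ Q" using X(2) by (auto simp: sublist_def)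
  define K where "K = int (length P)"
  have aX: "a (K + int i) = X ! i" if "i < length X" for i
  proof -
    have "W ! (length P + i) = X ! i" using that by (simp add: PQ nth_append)
    moreover have "length P + i < length W" using that by (simp add: PQ)
    ultimately show ?thesis unfolding W_def K_def by (simp add: nth_upto)
  qed
  obtain e0 where e0: "oseg p e0" "c K = emb e0" using represents_step[OF assms(1,2)] by blast
  obtain ws h where ws: "length ws = n" "X = map sgn_of (turns ws h)" "last ws = hor (snd e0)"
    using folding_turns_last[OF X(1) assms(4)] by blast
  have "ws \<noteq> []" using ws(1) assms(4) by auto
  then obtain d where d: "d \<in> set units" "hor d = h"
    "hd (inflate ws [((0, 0), d)]) = ((0, 0), snd e0)"
    using ex_direction[of "snd e0" ws h] e0(1) ws(3) by (auto simp: oseg_def)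
  define L where "L = inflate ws [((0, 0), d)]"
  have "L = walk ((0, 0), snd e0) (turns ws h)" using inflate_walk[of "((0, 0), d)" ws] d
    by (simp add: L_def)
  moreover have "e0 = shift (fst e0) ((0, 0), snd e0)" by (simp add: shift_def)
  ultimately have w: "walk e0 (turns ws h) = map (shift (fst e0)) L" by (metis walk_shift)
  have "map c [K..K + int (length (turns ws h))] = map emb (walk e0 (turns ws h))"
    using curve_walk[OF a(2) e0(2), of "turns ws h"] aX ws(2) by simp
  moreover have "K \<le> K + int (length (turns ws h))" by simp
  ultimately obtain l where l: "\<forall>e\<in>set l. oseg p e" "chain \<sigma> l"
    "map emb (walk e0 (turns ws h)) = map emb l"
    using represents_blocks[OF assms(1), of "map emb (walk e0 (turns ws h))"] assms(2) by metis
  have "l = map (shift (fst e0)) L" using l(3) w inj_map_eq_map[OF inj_emb] by metis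
  then have "\<forall>e\<in>set L. oseg (p = even_pt (fst e0)) e" "chain (\<lambda>z. \<sigma> (padd (fst e0) z)) L"
    using l(1,2) by (simp_all add: oseg_shift chain_shift)
  then show ?thesis using ws(1) d(1) unfolding L_def by blast
qed

lemma two_ended_in_covering:
  assumes "represents C p \<sigma>" "c \<in> C" "complete_folding_curve c"
  shows "\<exists>w. two_ended r (p = even_pt w) (\<lambda>z. \<sigma> (padd w z))"
proof -
  \<comment> \<open>14 is 5 + 9: finding the loop uses at most 5 signs, the remaining ones number at
    least \<open>6 * r + 9\<close>, and \<open>ex_nest\<close> then yields
    \<open>r \<le> k\<close>.\<close>
  obtain v ws0 d0 where b: "length ws0 = 6 * r + 14" "d0 \<in> set units"
      "\<forall>e\<in>set (inflate ws0 [((0, 0), d0)]). oseg (p = even_pt v) e"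
        "chain (\<lambda>z. \<sigma> (padd v z)) (inflate ws0 [((0, 0), d0)])"
    using folding_curve_block[OF assms, of "6 * r + 14"] by auto
  obtain u ws t v1 d where u: "ws0 = u @ ws" "length u \<le> 5" "d \<in> set units" "\<not> exceptional d ws"
     "sublist (pass t v1 d) (inflate u [((0,0), d0)])"
       "sublist (pass t v1 (pneg d)) (inflate u [((0,0), d0)])"
    using ex_loop[OF b(2), of ws0] b(1) by auto
  obtain k A B w q where n: "nest k q w A B" "length ws \<le> 6 * k + 9"
      "A k = inflate ws (pass t v1 d)" "B k = inflate ws (pass t v1 (pneg d))"
    using ex_nest[OF u(3,4)] by blast
  have "inflate ws0 [((0, 0), d0)] = inflate ws (inflate u [((0, 0), d0)])"
    by (simp add: u(1) inflate_append_word)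
  then have sub: "sublist (A k) (inflate ws0 [((0, 0), d0)])"
    "sublist (B k) (inflate ws0 [((0, 0), d0)])"
    using u(5,6) n(3,4) sublist_inflate by simp_all
  then have ch: "chain (\<lambda>z. \<sigma> (padd v z)) (A k)" "chain (\<lambda>z. \<sigma> (padd v z)) (B k)"
    using chain_sublist b(4) by blast+
  have "separate q w (A k) (B k)" using n(1) by (simp add: nest_def)
  then obtain e where "e \<in> set (A k)" "oseg q e" unfolding separate_def by blast
  moreover from this have "oseg (p = even_pt v) e" using b(3) sub(1) set_mono_sublist by blast
  ultimately have q: "q = (p = even_pt v)" by (auto simp: oseg_def)
  have "nest k (q = even_pt w) (0, 0) (\<lambda>j. map (shift (pneg w)) (A j)) (\<lambda>j. map (shift (pneg w)) (B j))"
    using nest_shift[OF n(1)] .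
  moreover have "chain (\<lambda>z. \<sigma> (padd v (padd w z))) (map (shift (pneg w)) L)"
    if "chain (\<lambda>z. \<sigma> (padd v z)) L" for L
    using that by (simp add: chain_shift padd_pneg_cancel)
  ultimately have "two_ended k (q = even_pt w) (\<lambda>z. \<sigma> (padd v (padd w z)))" using ch
    unfolding two_ended_def by blast
  moreover have "(q = even_pt w) = (p = even_pt (padd v w))" by (auto simp: q even_pt_padd)
  moreover have "r \<le> k" using u(1,2) n(2) b(1) by simp
  ultimately have "two_ended r (p = even_pt (padd v w)) (\<lambda>z. \<sigma> (padd (padd v w) z))"
    using two_ended_mono by (simp add: padd_assoc)
  then show ?thesis by blast
qed

lemma finite_l1: "finite {z. l1 z \<le> m}"
proof -
  have "z \<in> {- m..m} \<times> {- m..m}" if "l1 z \<le> m" for z using that by (cases z) (auto simp: l1_def)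
  then have "{z. l1 z \<le> m} \<subseteq> {- m..m} \<times> {- m..m}" by blast
  then show ?thesis by (rule finite_subset) simp
qed

lemma finite_norm: "finite {z. norm (cpx z) \<le> r}"
proof -
  have "l1 z \<le> \<lceil>2 * r\<rceil>" if "norm (cpx z) \<le> r" for z
  proof -
    have "\<bar>Re (cpx z)\<bar> \<le> r" "\<bar>Im (cpx z)\<bar> \<le> r" using that abs_Re_le_cmod abs_Im_le_cmod order_trans
      by blast+
    then have "real_of_int (l1 z) \<le> 2 * r" by (simp add: l1_def cpx_def)
    then show ?thesis by linarith
  qed
  then have "{z. norm (cpx z) \<le> r} \<subseteq> {z. l1 z \<le> \<lceil>2 * r\<rceil>}" by blast
  then show ?thesis using finite_l1 finite_subset by blast
qed

lemma orbit_orbit: "orbit \<sigma> (orbit \<sigma> e a) b = orbit \<sigma> e (a + b)"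
proof (cases "0 \<le> b")
  case True
  then show ?thesis using orbit_add_nat[of \<sigma> e a "nat b"]
    by (simp add: orbit_def[of \<sigma> "orbit \<sigma> e a"])
next
  case False
  define n where "n = nat (- b)"
  have b: "b = - int n" using False by (simp add: n_def)
  have "(nxt \<sigma> ^^ n) (orbit \<sigma> (orbit \<sigma> e a) b) = orbit \<sigma> e a"
    using orbit_add_nat[of \<sigma> "orbit \<sigma> e a" b n] by (simp add: b)
  moreover have "(nxt \<sigma> ^^ n) (orbit \<sigma> e (a + b)) = orbit \<sigma> e a"
    using orbit_add_nat[of \<sigma> e "a + b" n] by (simp add: b)
  moreover have "inj (nxt \<sigma> ^^ n)" by (induction n) (auto simp: inj_compose inj_def inj_nxt)
  ultimately show ?thesis by (metis injD)
qed

lemma two_curves: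
  assumes "oseg p e1" "oseg p e2" "\<And>e. oseg p e \<Longrightarrow> (\<exists>k. e = orbit \<sigma> e1 k) \<or> (\<exists>k. e = orbit \<sigma> e2 k)"
    "\<And>k. orbit \<sigma> e1 k \<noteq> e2" "\<And>e n. oseg p e \<Longrightarrow> 0 < n \<Longrightarrow> (nxt \<sigma> ^^ n) e \<noteq> e"
  shows "\<exists>D. represents D p \<sigma> \<and> card D = 2"
proof -
  define c where "c e = (\<lambda>k. emb (orbit \<sigma> e k))" for e
  define D where "D = {c e1, c e2}"
  have apart: "orbit \<sigma> e1 k \<noteq> orbit \<sigma> e2 k'" for k k'
  proof
    assume "orbit \<sigma> e1 k = orbit \<sigma> e2 k'"
    then have "orbit \<sigma> e1 (k - k') = e2"
      using orbit_orbit[of \<sigma> e1 k "- k'"] orbit_orbit[of \<sigma> e2 k' "- k'"] by simp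
    then show False using assms(4) by blast
  qed
  have inj: "k = k'" if eq: "orbit \<sigma> e k = orbit \<sigma> e k'" and e: "oseg p e" for e k k'
  proof (rule ccontr)
    have False if "orbit \<sigma> e a = orbit \<sigma> e b" "a < b" for a b
    proof -
      have "orbit \<sigma> e b = (nxt \<sigma> ^^ nat (b - a)) (orbit \<sigma> e a)"
        using orbit_add_nat[of \<sigma> e a "nat (b - a)"] that(2) by simp
      then show False using assms(5)[OF orbit_oseg[OF e], of "nat (b - a)" \<sigma> a] that by simp
    qed
    moreover assume "k \<noteq> k'"
    ultimately show False using eq by (metis linorder_neq_iff)
  qed
  have "c e1 \<noteq> c e2"
  proof
    assume "c e1 = c e2"
    then have "c e1 0 = c e2 0" by simp
    then show False using apart[of 0 0] by (simp add: c_def)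
  qed
  then have "card D = 2" by (simp add: D_def)
  moreover have "represents D p \<sigma>"
    unfolding represents_def
  proof (intro conjI ballI allI impI)
    fix x k assume "x \<in> D"
    then obtain e where "oseg p e" "x = c e" using assms(1,2) unfolding D_def by blast
    then show "\<exists>e. oseg p e \<and> x k = emb e \<and> x (k + 1) = emb (nxt \<sigma> e)"
      by (intro exI[of _ "orbit \<sigma> e k"]) (simp add: c_def orbit_oseg orbit_Suc)
  next
    fix e assume e: "oseg p e"
    then obtain x k where x: "x \<in> D" "x k = emb e" using assms(3)[OF e] by (auto simp: D_def c_def)
    have uniq: "y = x \<and> k' = k" if y: "y \<in> D" "y k' = emb e" for y k'
    proof -
      have "x k = y k'" using x y by simp
      then show ?thesis
        using x(1) y(1) apart[of k k'] apart[of k' k] inj[of e1 k k'] inj[of e2 k k'] assms(1,2)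
        by (auto simp: D_def c_def)
    qed
    show "\<exists>!ck. fst ck \<in> D \<and> fst ck (snd ck) = emb e"
    proof (rule ex1I[of _ "(x, k)"])
      fix ck assume "fst ck \<in> D \<and> fst ck (snd ck) = emb e"
      then show "ck = (x, k)" using uniq[of "fst ck" "snd ck"] by (simp add: prod_eq_iff)
    qed (simp add: x)
  qed
  ultimately show ?thesis by blast
qed

lemma translate_translate: "translate u (translate v B) = translate (v + u) B"
  by (simp add: translate_def image_image comp_def add.assoc)

lemma Nil_translate: "[] \<in> translate v B \<longleftrightarrow> [] \<in> B"
  by (auto simp: translate_def)

lemma bounded_curvesD: "bounded_curves B \<Longrightarrow> finite B \<and> [] \<notin> B"
  by (auto simp: bounded_curves_def finite_curve_def)

theorem proposition7:
  fixes C :: "(int \<Rightarrow> seg) set"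
  assumes "covering C"
    and "\<forall>c\<in>C. complete_folding_curve c"
    and "local_isomorphism_property C"
  shows "\<exists>D. covering D \<and> card D = 2 \<and> locally_isomorphic C D"
proof -
  obtain p \<sigma> where represents: "represents C p \<sigma>" using covering_represents[OF assms(1)] by blast
  have "\<exists>e. oseg p e"
  proof -
    have "oseg p ((0, 0), if p then (1, 0) else (0, 1))" by (simp add: oseg_def units_def hor_def)
    then show ?thesis by blast
  qed
  then obtain c where c: "c \<in> C" using represents_ex[OF represents] by blast
  then have "\<forall>r. \<exists>w. two_ended r (p = even_pt w) (\<lambda>z. \<sigma> (padd w z))"
    using two_ended_in_covering[OF represents] assms(2) by blast
  then obtain w where w: "\<And>r. two_ended r (p = even_pt (w r)) (\<lambda>z. \<sigma> (padd (w r) z))" by metis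
  \<comment> \<open>The index \<open>None\<close> records the orientation convention of the
    translate and \<open>Some z\<close> its sign at \<open>z\<close>, so that both converge
    together.\<close>
  define f where "f r = case_option (p = even_pt (w r)) (\<lambda>z. \<sigma> (padd (w r) z))" for r
  obtain g where g: "\<And>F N. finite F \<Longrightarrow> \<exists>k\<ge>N. \<forall>z\<in>F. f k z = g z" using ex_limit[of f] by blast
  define q where "q = g None"
  define \<tau> where "\<tau> z = g (Some z)" for z
  have lim: "\<exists>k\<ge>N. (p = even_pt (w k)) = q \<and> (\<forall>z\<in>F. \<sigma> (padd (w k) z) = \<tau> z)"
    if fin: "finite F" for F N
  proof -
    obtain k where "k \<ge> N" "\<forall>z\<in>insert None (Some ` F). f k z = g z"
      using g[of "insert None (Some ` F)" N] fin by auto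
    then show ?thesis unfolding f_def q_def \<tau>_def by (intro exI[of _ k]) simp
  qed
  \<comment> \<open>A translate with \<open>k \<ge> r\<close> that agrees with the limit on a large
    ball passes its first \<open>r\<close> stages on to the limit.\<close>
  have "two_ended r q \<tau>" for r
  proof -
    obtain k where "k \<ge> r" "(p = even_pt (w k)) = q"
      "\<forall>z\<in>{z. l1 z \<le> 2 ^ (6 * r + 10)}. \<sigma> (padd (w k) z) = \<tau> z"
      using lim[OF finite_l1] by blast
    then show ?thesis using two_ended_local[OF two_ended_mono[OF w[of k]]] by simp
  qed
  then obtain e1 e2 where e12: "oseg q e1" "oseg q e2"
    "\<And>e. oseg q e \<Longrightarrow> (\<exists>k. e = orbit \<tau> e1 k) \<or> (\<exists>k. e = orbit \<tau> e2 k)"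
     "\<And>k. orbit \<tau> e1 k \<noteq> e2" using two_orbits[of q \<tau>] by metis
  \<comment> \<open>A closed orbit of the limit involves finitely many signs, so some translate
    would contain it.\<close>
  have "(nxt \<tau> ^^ n) e \<noteq> e" if e: "oseg q e" "0 < n" for e n
  proof
    assume eq: "(nxt \<tau> ^^ n) e = e"
    obtain k where k: "(p = even_pt (w k)) = q"
      "\<forall>z\<in>(\<lambda>i. iend ((nxt \<tau> ^^ i) e)) ` {..n}. \<sigma> (padd (w k) z) = \<tau> z"
      using lim[of "(\<lambda>i. iend ((nxt \<tau> ^^ i) e)) ` {..n}"] by auto
    have "i \<le> n \<Longrightarrow> (nxt (\<lambda>z. \<sigma> (padd (w k) z)) ^^ i) e = (nxt \<tau> ^^ i) e" for i
      by (induction i) (use k(2) in \<open>auto simp: nxt_def\<close>)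
    then have "(nxt \<sigma> ^^ n) (shift (w k) e) = shift (w k) e" using eq by (simp add: nxt_pow_shift)
    moreover have "oseg p (shift (w k) e)" using e(1) k(1) by (simp add: oseg_shift)
    ultimately show False using represents_aperiodic[OF represents] e(2) by blast
  qed
  then obtain D where D: "represents D q \<tau>" "card D = 2" using two_curves[OF e12] by blast
  \<comment> \<open>Each bounded part of the limit is found in a translate of \<open>C\<close> that
    agrees with the limit on all its end points.\<close>
  have "locally_embeds D C"
    unfolding locally_embeds_def
  proof (intro allI impI)
    fix B assume B: "bounded_curves B \<and> sub_curves B D"
    then obtain BL where BL: "finite BL" "[] \<notin> BL" "B = map emb ` BL"
      using sub_curves_embedded[OF D(1), of B] bounded_curvesD[of B] by blast
    have "sub_chains BL q \<tau>" using B sub_curves_sub_chains[OF D(1) BL(2)] BL(3) by simp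
    have "finite (iend ` (\<Union>b\<in>BL. set b))" using BL(1) by simp
    from lim[OF this, of 0] obtain k where k: "(p = even_pt (w k)) = q"
      "\<forall>z\<in>iend ` (\<Union>b\<in>BL. set b). \<sigma> (padd (w k) z) = \<tau> z"
      by blast
    have "sub_chains BL q (\<lambda>z. \<sigma> (padd (w k) z)) = sub_chains BL q \<tau>"
      by (rule sub_chains_cong) (use k(2) in blast)
    then have "sub_chains (map (shift (w k)) ` BL) p \<sigma>" using \<open>sub_chains BL q \<tau>\<close> k(1)
      by (simp add: sub_chains_shift)
    moreover have "[] \<notin> map (shift (w k)) ` BL" using BL(2) by auto
    ultimately have "sub_curves (map emb ` (map (shift (w k)) ` BL)) C"
      using sub_curves_sub_chains[OF represents] by blast
    then show "\<exists>B'. sub_curves B' C \<and> translation_equiv B B'"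
      unfolding translation_equiv_def BL(3) translate_emb[symmetric] by blast
  qed
  moreover have "locally_embeds C D"
    unfolding locally_embeds_def
  proof (intro allI impI)
    fix B assume B: "bounded_curves B \<and> sub_curves B C"
    \<comment> \<open>The radius is the same for all centres. So it can be fixed before
      \<open>k\<close> is chosen such that the translate by \<open>w k\<close> agrees with the limit
      up to distance \<open>r\<close>; a copy of \<open>B\<close> close to \<open>w k\<close> then
      moves into \<open>D\<close>.\<close>
    then obtain r
      where r: "\<And>z. \<exists>B'. sub_curves B' C \<and> translation_equiv B B' \<and>
      (\<forall>b\<in>B'. \<forall>s\<in>set b. seg_support s \<subseteq> cball z r)"
      using assms(3) unfolding local_isomorphism_property_def by blast
    obtain k where k: "(p = even_pt (w k)) = q" "\<forall>z\<in>{z. norm (cpx z) \<le> r}. \<sigma> (padd (w k) z) = \<tau> z"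
      using lim[OF finite_norm, of 0] by blast
    obtain B' v where B': "sub_curves B' C" "B' = translate v B"
      "\<forall>b\<in>B'. \<forall>s\<in>set b. seg_support s \<subseteq> cball (cpx (w k)) r"
      using r[of "cpx (w k)"] unfolding translation_equiv_def by blast
    have "finite B'" "[] \<notin> B'" using bounded_curvesD B Nil_translate unfolding B'(2)
      by (auto simp: translate_def)
    then obtain BL where BL: "finite BL" "[] \<notin> BL" "B' = map emb ` BL"
      using sub_curves_embedded[OF represents _ _ B'(1)] by blast
    define BL' where "BL' = map (shift (pneg (w k))) ` BL"
    have BL': "BL = map (shift (w k)) ` BL'" by (simp add: BL'_def image_image comp_def)
    have "sub_chains BL p \<sigma>" using B'(1) sub_curves_sub_chains[OF represents BL(2)] BL(3) by simp
    then have "sub_chains BL' q (\<lambda>z. \<sigma> (padd (w k) z))" unfolding BL' sub_chains_shift k(1) .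
    moreover have "sub_chains BL' q (\<lambda>z. \<sigma> (padd (w k) z)) = sub_chains BL' q \<tau>"
    proof (rule sub_chains_cong)
      fix l e assume "l \<in> BL'" "e \<in> set l"
      then have "map emb (map (shift (w k)) l) \<in> B'" unfolding BL(3) BL' by (intro imageI)
      moreover have "emb (shift (w k) e) \<in> set (map emb (map (shift (w k)) l))" using \<open>e \<in> set l\<close>
        by simp
      ultimately have "seg_support (emb (shift (w k) e)) \<subseteq> cball (cpx (w k)) r" using B'(3) by blast
      then have "seg_end (emb (shift (w k) e)) \<in> cball (cpx (w k)) r"
        by (auto simp: seg_support_def)
      then have "norm (cpx (iend e)) \<le> r" by (simp add: seg_end_emb iend_shift cpx_padd dist_norm)
      then show "\<sigma> (padd (w k) (iend e)) = \<tau> (iend e)" using k(2) by blast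
    qed
    moreover have "[] \<notin> BL'" using BL(2) by (auto simp: BL'_def)
    ultimately have "sub_curves (map emb ` BL') D" using sub_curves_sub_chains[OF D(1)] by blast
    moreover have "map emb ` BL' = translate (v + cpx (pneg (w k))) B"
      unfolding BL'_def translate_emb[symmetric] BL(3)[symmetric] B'(2) translate_translate ..
    ultimately show "\<exists>B'. sub_curves B' D \<and> translation_equiv B B'" unfolding translation_equiv_def
      by blast
  qed
  ultimately show ?thesis using D represents_covering[OF D(1)] unfolding locally_isomorphic_def
    by blast
qed

end
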